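(* Let $H$ be a real Hilbert space, $d\in\mathbb{N}^*$, and let $C\subset H$ be a bounded closed convex subset with $d\ge\operatorname{diam}(C)$. Let $T:C\to C$ be nonexpansive and let $\mathcal{G}:C\to C$ be a strict contraction with Lipschitz constant $\tau<1$. Let $(\lambda_n)$ be a sequence in $(0,1]$ that converges to $0$, let $h:\mathbb{N}\to\mathbb{N}^*$ be such that $\lambda_n\ge\frac{1}{h(n)}$ for all $n\in\mathbb{N}$, and let $\chi:\mathbb{N}\to\mathbb{N}$ be a rate of convergence of $(\lambda_n)$ towards $0$, i.e. $\lambda_i\le\frac{1}{n+1}$ for all nonnegative integers $n$ and all $i\ge\chi(n)$. Suppose that $\phi_1,\phi_2:(0,\infty)\to\mathbb{N}$ satisfy (i) $\sum_{i=1}^{\phi_1(k)}\lambda_i\ge k$ for all nonnegative integers $k$, and (ii) $\frac{|\lambda_n-\lambda_{n+1}|}{\lambda_{n+1}^2}\le\varepsilon$ for all $\varepsilon>0$ and $n\ge\phi_2(\varepsilon)$. Define the sequence $(u_n)$ by $u_{n+1}:=(1-\lambda_{n+1})Tu_n+\lambda_{n+1}\mathcal{G}Tu_n$ for an arbitrary starting point $u_0\in C$. Then, for all $\varepsilon\in(0,1]$, $g:\mathbb{N}\to\mathbb{N}$ and $v\in C$, there exists an $n\le\Xi(\varepsilon/6,g_c,\chi,h,d)+c$, where $$g_c(n):=n+c+g(n+c),\qquad c:=\phi_1\!\left(\frac{\phi_2\big((1-\tau)\varepsilon/6d\big)+\log(6d/\varepsilon)}{1-\tau}\right),$$ such that $$\|u_i-u_j\|\le\varepsilon\quad\text{for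 all } i,j\in[n;n+g(n)].$$ Here $\Xi$ is the explicit functional defined in the context.
   Context: $\mathbb{N}$ denotes the nonnegative integers and $\mathbb{N}^*$ the positive integers. $[n;n+m]:=\{n,n+1,\dots,n+m\}$. $F^{(m)}$ denotes the $m$-fold iterate of a function $F$. For a function $F$ on $\mathbb{N}^*$ (or $\mathbb{N}$) with values in $\mathbb{N}$, $F^M(n):=\max\{F(i): i\le n\}$, with $i$ ranging over the domain of $F$. For $g:\mathbb{N}\to\mathbb{N}$, $\tilde g(n):=\max\{n,g(n)\}$. Expressions such as $\varepsilon/6d$ mean $\varepsilon/(6d)$. Definition of $\Xi(\varepsilon,g,\chi,h,d)$, with $\tau$ the contraction constant of $\mathcal{G}$: put $$\varepsilon_d:=\frac{(\varepsilon/2)^4}{8(1-\tau)^2d^2},\quad \tilde\varepsilon:=\frac{(1-\tau)^2}{6+8d}\,\varepsilon_d,\quad n_{\tilde\varepsilon}:=\lceil 8d^4/\tilde\varepsilon^4\rceil,\quad i_0:=\lceil\log_\tau(\tilde\varepsilon/6d^2)-1\rceil,$$ $$f(n):=\left\lceil\frac{6d(1-\tau)\,h^M\big(\tilde g^M(\chi(d\cdot n))\big)}{(\varepsilon/2)^2}\right\rceil,\qquad \tilde f(n):=\max\{f^M(16dn^2),16dn^2\},$$ $$f_i(k):=\tilde f^{(n_{\tilde\varepsilon}^i)}(k),\qquad \tilde f_i(n):=\max\{f_i^M(16dn^2),16dn^2\},$$ $$k_0(\tilde f):=\tilde f_0^{(n_{\tilde\varepsilon})}(1),\qquad k_{i+1}(\tilde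 f):=\tilde f_i^{(n_{\tilde\varepsilon})}(k_i(\tilde f)).$$ Then $\Xi(\varepsilon,g,\chi,h,d):=\chi\big(d\cdot k_{i_0}(\tilde f)\big)$.
   Formalization: Condition (i) is assumed for every real k > 0, not only for integers k: c evaluates φ1 at a generally non-integer real, where φ1 would otherwise be unconstrained and the stated bound can fail. *)

theory Defs
  imports "HOL-Analysis.Analysis"
begin

definition max_upto :: "(nat \<Rightarrow> nat) \<Rightarrow> nat \<Rightarrow> nat"  (* \<open>F\<^sup>M\<close> *)
  where "max_upto F n = Max (F ` {..n})"

definition max_id :: "(nat \<Rightarrow> nat) \<Rightarrow> nat \<Rightarrow> nat"  (* \<open>g\<close> with tilde *)
  where "max_id g n = max n (g n)"

definition eps_d :: "real \<Rightarrow> real \<Rightarrow> nat \<Rightarrow> real"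
  where "eps_d \<tau> \<epsilon> d = (\<epsilon> / 2) ^ 4 / (8 * (1 - \<tau>)\<^sup>2 * (real d)\<^sup>2)"

definition eps_tilde :: "real \<Rightarrow> real \<Rightarrow> nat \<Rightarrow> real"
  where "eps_tilde \<tau> \<epsilon> d = (1 - \<tau>)\<^sup>2 / (6 + 8 * real d) * eps_d \<tau> \<epsilon> d"

definition n_eps :: "real \<Rightarrow> real \<Rightarrow> nat \<Rightarrow> nat"
  where "n_eps \<tau> \<epsilon> d = nat \<lceil>8 * real d ^ 4 / eps_tilde \<tau> \<epsilon> d ^ 4\<rceil>"

(* For \<open>\<tau> = 0\<close> (a constant map \<open>G\<close>) the library value \<open>log 0 x = 0\<close> makes
   \<open>i_zero\<close> equal to 0, which is also its value for all sufficiently small \<open>\<tau> > 0\<close>. *)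
definition i_zero :: "real \<Rightarrow> real \<Rightarrow> nat \<Rightarrow> nat"
  where "i_zero \<tau> \<epsilon> d = nat \<lceil>log \<tau> (eps_tilde \<tau> \<epsilon> d / (6 * (real d)\<^sup>2)) - 1\<rceil>"

definition f_fun ::
    "real \<Rightarrow> real \<Rightarrow> (nat \<Rightarrow> nat) \<Rightarrow> (nat \<Rightarrow> nat) \<Rightarrow> (nat \<Rightarrow> nat) \<Rightarrow> nat \<Rightarrow> nat \<Rightarrow> nat"
  where "f_fun \<tau> \<epsilon> g chi h d n =
    nat \<lceil>6 * real d * (1 - \<tau>) * real (max_upto h (max_upto (max_id g) (chi (d * n)))) / (\<epsilon> / 2)\<^sup>2\<rceil>"

(* The passage from \<open>f\<close> to \<open>f\<close> with tilde, and likewise from \<open>f\<^sub>i\<close> to \<open>f\<^sub>i\<close> with tilde. *)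
definition tilde :: "nat \<Rightarrow> (nat \<Rightarrow> nat) \<Rightarrow> nat \<Rightarrow> nat"
  where "tilde d F n = max (max_upto F (16 * d * n\<^sup>2)) (16 * d * n\<^sup>2)"

(* \<open>f\<^sub>i\<close>, where \<open>F\<close> is \<open>f\<close> with tilde and \<open>N\<close> is \<open>n_eps\<close>. *)
definition f_level :: "nat \<Rightarrow> (nat \<Rightarrow> nat) \<Rightarrow> nat \<Rightarrow> nat \<Rightarrow> nat"
  where "f_level N F i = F ^^ (N ^ i)"

(* The step from \<open>i\<close> to \<open>i + 1\<close> uses level \<open>i\<close>, so level 0 is used twice. *)
primrec k_seq :: "nat \<Rightarrow> nat \<Rightarrow> (nat \<Rightarrow> nat) \<Rightarrow> nat \<Rightarrow> nat" where
  "k_seq d N F 0 = (tilde d (f_level N F 0) ^^ N) 1"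
| "k_seq d N F (Suc i) = (tilde d (f_level N F i) ^^ N) (k_seq d N F i)"

definition Xi ::
    "real \<Rightarrow> real \<Rightarrow> (nat \<Rightarrow> nat) \<Rightarrow> (nat \<Rightarrow> nat) \<Rightarrow> (nat \<Rightarrow> nat) \<Rightarrow> nat \<Rightarrow> nat"
  where "Xi \<tau> \<epsilon> g chi h d =
    chi (d * k_seq d (n_eps \<tau> \<epsilon> d) (tilde d (f_fun \<tau> \<epsilon> g chi h d)) (i_zero \<tau> \<epsilon> d))"

end

theory Submission imports Defs begin

text \<open>
  Write \<open>t n = T (u n)\<close> and \<open>\<rho> = 1 - \<tau>\<close>. Instead of comparing \<open>u\<close> with the curve of fixed points of
  \<open>(1 - lam n) T + lam n (G \<circ> T)\<close>, the proof analyses the iteration itself, because the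
  bound that the choice of \<open>c\<close> yields for the distance of \<open>u n\<close> from that curve deteriorates
  like \<open>1 / \<rho>\<close>.

  Let \<open>k 0 = 1\<close> and let \<open>k (i + 1)\<close> be \<open>f\<close> with tilde at \<open>k i\<close>. A subsequence of the \<open>k i\<close> gives
  a decreasing sequence of closed convex sets \<open>K j\<close>, the closed convex hulls of the
  \<open>1 / k i\<close>-fixed points of \<open>T\<close>. In a Hilbert space the points of \<open>K j\<close> are still almost fixed
  (\<open>almost_fixed_hull_displacement\<close>). After some index all \<open>t n\<close> lie in \<open>K j\<close>, while the points of
  \<open>K (j + 1)\<close> are so nearly fixed that \<open>T\<close> moves them by much less than \<open>lam n\<close>, for all
  \<open>n\<close> up to the horizon fixed by the counterfunction. Expanding \<open>norm (t (n + 1) - q)\<close> squared for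
  \<open>q\<close> in \<open>K (j + 1)\<close> and summing with increasing weights shows that the \<open>t n\<close> solve, on average,
  the variational inequality \<open>(G t - t) \<bullet> (q - t) \<le> 0\<close>; the last term of the sum is retained and
  controls the end point \<open>x\<close> of the window. This is \<open>approx_solution\<close>, established in
  \<open>window_approx_solution\<close>.

  It remains to find \<open>j\<close> and one point \<open>Q\<close> close to the end points of all such averaged solutions
  between \<open>K j\<close> and \<open>K (j + 1)\<close>. For a fixed \<open>v\<close> the squared distance from \<open>v\<close> to \<open>K i\<close> increases
  with \<open>i\<close> and is bounded, so on some long interval of indices it increases by at most \<open>\<delta>\<^sup>2\<close>. On
  such an interval the nearest point \<open>p\<close> to \<open>v\<close> satisfies \<open>approx_solution_step\<close>: the mean of
  \<open>norm (p - t n)\<close> squared is at most that of \<open>norm (v - G (t n))\<close> squared, up to a factor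
  \<open>1 / (1 - \<kappa>)\<close> that does not spoil the contraction and an error of order \<open>\<delta>\<^sup>2\<close>.
  Since \<open>G\<close> contracts, passing from \<open>v\<close> to \<open>G p\<close> and to a subinterval can be repeated until the error is small. That the error is quadratic in
  \<open>\<delta>\<close> is essential: \<open>\<delta>\<^sup>2\<close> may then be of order \<open>\<rho>\<close> instead of \<open>\<rho>\<^sup>2\<close>.

  For \<open>\<tau> \<le> 1/2\<close> the repetition is a plain Picard iteration of \<open>i_zero + 1\<close> levels
  (\<open>Picard_search\<close>). For \<open>\<tau>\<close> near 1 it would subdivide each interval into about \<open>1 / \<rho>\<close> pieces at
  each of about \<open>1 / \<rho>\<close> levels, which exceeds \<open>n_eps ^ i_zero\<close> when \<open>\<tau>\<close> is close enough to 1. There \<open>v\<close> is replaced by the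
  midpoint of \<open>v\<close> and \<open>G p\<close> (\<open>averaged_search\<close>). The squared step lengths then have a bounded sum, and a
  step of length \<open>r\<close> costs only of the order of \<open>1 + (r / \<delta>)\<^sup>2\<close> pieces, because a small change of \<open>v\<close> keeps
  the increments of the squared distance small (\<open>sqdist_increment_perturb\<close>). Hence the product of all
  the numbers of pieces is at most exponential in \<open>1 / \<rho>\<close>, which fits into \<open>n_eps ^ i_zero\<close>
  (\<open>stable_index_exists\<close>).
\<close>

section \<open>Nearest points of closed convex sets\<close>

text \<open>
  A minimizing sequence is Cauchy by the parallelogram law, so completeness replaces the local
  compactness that is needed for \<^const>\<open>closest_point\<close>. The nearest point is recorded by its obtuse angle
  property, the only one used below.
\<close>

lemma exists_nearest_point:
  fixes A :: "'a::{real_inner, complete_space} set"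
  assumes "closed A" "convex A" "A \<noteq> {}"
  shows "\<exists>p\<in>A. \<forall>z\<in>A. (v - p) \<bullet> (z - p) \<le> 0"
proof -
  define D where "D = infdist v A"
  have D: "D \<le> dist v z" if "z \<in> A" for z
    using that by (simp add: D_def infdist_le)
  have D0: "0 \<le> D" by (simp add: D_def infdist_nonneg)
  have "\<exists>z\<in>A. (dist v z)\<^sup>2 < D\<^sup>2 + 1 / real (Suc n)" for n
  proof -
    have "D < sqrt (D\<^sup>2 + 1 / real (Suc n))"
      by (rule real_less_rsqrt) simp
    then have "(INF a\<in>A. dist v a) < sqrt (D\<^sup>2 + 1 / real (Suc n))"
      using assms(3) by (simp add: D_def infdist_def)
    then obtain z where z: "z \<in> A" "dist v z < sqrt (D\<^sup>2 + 1 / real (Suc n))"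
      using assms(3) by (metis (no_types, lifting) cInf_lessD image_is_empty imageE)
    have "(dist v z)\<^sup>2 < (sqrt (D\<^sup>2 + 1 / real (Suc n)))\<^sup>2"
      by (rule power_strict_mono) (use z in auto)
    then show ?thesis using z(1) by auto
  qed
  then obtain x where xA: "\<And>n. x n \<in> A"
    and x: "\<And>n. (dist v (x n))\<^sup>2 < D\<^sup>2 + 1 / real (Suc n)" by metis
  have close: "(dist (x m) (x n))\<^sup>2 \<le> 2 / real (Suc m) + 2 / real (Suc n)" for m n
  proof -
    have "(1/2) *\<^sub>R x m + (1/2) *\<^sub>R x n \<in> A"
      using assms(2) xA[of m] xA[of n] unfolding convex_def by auto
    then have "D\<^sup>2 \<le> (dist v ((1/2) *\<^sub>R x m + (1/2) *\<^sub>R x n))\<^sup>2"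
      using D D0 by (intro power_mono) auto
    moreover have "(dist (x m) (x n))\<^sup>2 = 2 * (dist v (x m))\<^sup>2 + 2 * (dist v (x n))\<^sup>2
        - 4 * (dist v ((1/2) *\<^sub>R x m + (1/2) *\<^sub>R x n))\<^sup>2"
      unfolding dist_norm power2_norm_eq_inner by (simp add: inner_simps inner_commute algebra_simps)
    ultimately show ?thesis using x[of m] x[of n] by simp
  qed
  have "Cauchy x"
  proof (rule metric_CauchyI)
    fix e :: real assume e: "0 < e"
    obtain M :: nat where M: "4 / e\<^sup>2 < real M" using reals_Archimedean2 by blast
    have "dist (x m) (x n) < e" if "M \<le> m" "M \<le> n" for m n
    proof -
      have M0: "0 < real M" using M e by (smt (verit) divide_pos_pos zero_less_power)
      have "2 / real (Suc m) + 2 / real (Suc n) \<le> 2 / real M + 2 / real M"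
        by (intro add_mono divide_left_mono) (use that M0 in auto)
      also have "\<dots> < e\<^sup>2" using M M0 e by (simp add: field_simps)
      finally have "(dist (x m) (x n))\<^sup>2 < e\<^sup>2" using close[of m n] by simp
      then show ?thesis using power_less_imp_less_base[of _ 2 e] e by simp
    qed
    then show "\<exists>M. \<forall>m\<ge>M. \<forall>n\<ge>M. dist (x m) (x n) < e" by blast
  qed
  then obtain p where p: "x \<longlonglongrightarrow> p" using Cauchy_convergent convergent_def by blast
  have pA: "p \<in> A" using assms(1) p xA closed_sequentially by blast
  have "(\<lambda>n. (dist v (x n))\<^sup>2) \<longlonglongrightarrow> (dist v p)\<^sup>2"
    by (intro tendsto_intros p)
  moreover have "(\<lambda>n. D\<^sup>2 + 1 / real (Suc n)) \<longlonglongrightarrow> D\<^sup>2 + 0"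
    by (intro tendsto_intros LIMSEQ_Suc[OF lim_1_over_n])
  ultimately have "(dist v p)\<^sup>2 \<le> D\<^sup>2 + 0"
    by (rule LIMSEQ_le) (intro exI allI impI less_imp_le x)
  then have "dist v p \<le> D" using power2_le_imp_le[OF _ D0, of "dist v p"] by simp
  then have "\<forall>z\<in>A. dist v p \<le> dist v z" using D order_trans by blast
  then show ?thesis
    using any_closest_point_dot[OF assms(2,1) pA] pA by blast
qed

definition nearest :: "'a::real_inner set \<Rightarrow> 'a \<Rightarrow> 'a"
  where "nearest A v = (SOME p. p \<in> A \<and> (\<forall>z\<in>A. (v - p) \<bullet> (z - p) \<le> 0))"

lemma nearest:
  fixes A :: "'a::{real_inner, complete_space} set"
  assumes "closed A" "convex A" "A \<noteq> {}"
  shows nearest_mem: "nearest A v \<in> A"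
    and nearest_obtuse: "z \<in> A \<Longrightarrow> (v - nearest A v) \<bullet> (z - nearest A v) \<le> 0"
proof -
  have "\<exists>p. p \<in> A \<and> (\<forall>z\<in>A. (v - p) \<bullet> (z - p) \<le> 0)"
    using exists_nearest_point[OF assms, of v] by blast
  from someI_ex[OF this]
  show "nearest A v \<in> A" "z \<in> A \<Longrightarrow> (v - nearest A v) \<bullet> (z - nearest A v) \<le> 0"
    unfolding nearest_def by blast+
qed

lemma nearest_Pythagoras:
  fixes A :: "'a::{real_inner, complete_space} set"
  assumes "closed A" "convex A" "A \<noteq> {}" "z \<in> A"
  shows "(norm (v - nearest A v))\<^sup>2 + (norm (nearest A v - z))\<^sup>2 \<le> (norm (v - z))\<^sup>2"
proof -
  have "(norm (v - z))\<^sup>2 = (norm (v - nearest A v))\<^sup>2 + (norm (nearest A v - z))\<^sup>2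
      - 2 * ((v - nearest A v) \<bullet> (z - nearest A v))"
    unfolding power2_norm_eq_inner by (simp add: inner_simps inner_commute)
  then show ?thesis using nearest_obtuse[OF assms(1-4), of v] by simp
qed

abbreviation sqdist :: "'a::real_inner set \<Rightarrow> 'a \<Rightarrow> real"
  where "sqdist A v \<equiv> (norm (v - nearest A v))\<^sup>2"

lemma sqdist_antimono:
  fixes A B :: "'a::{real_inner, complete_space} set"
  assumes "closed A" "convex A" "closed B" "convex B" "B \<noteq> {}" "B \<subseteq> A"
  shows "sqdist A v + (norm (nearest A v - nearest B v))\<^sup>2 \<le> sqdist B v"
  by (rule nearest_Pythagoras[OF assms(1,2)]) (use nearest_mem[OF assms(3-5)] assms(5,6) in blast)+

text \<open>
  The squared distance to a convex set is a convex function with derivative twice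
  \<open>v - nearest A v\<close>. Between two nested sets whose nearest points to \<open>v\<close> are within \<open>\<delta>\<close>, its increment therefore
  changes at most by \<open>2 \<delta> r + r\<^sup>2\<close> when \<open>v\<close> moves by \<open>r\<close>.
\<close>

lemma sqdist_increment_perturb:
  fixes A B :: "'a::{real_inner, complete_space} set"
  assumes A: "closed A" "convex A" and B: "closed B" "convex B" "B \<noteq> {}" and BA: "B \<subseteq> A"
    and inc: "sqdist B v - sqdist A v \<le> \<delta>\<^sup>2" and "0 \<le> \<delta>"
  shows "sqdist B v' - sqdist A v' \<le> 2 * \<delta>\<^sup>2 + 2 * (norm (v' - v))\<^sup>2"
proof -
  have Ane: "A \<noteq> {}" using B BA by auto
  define p q p' where "p = nearest A v" and "q = nearest B v" and "p' = nearest A v'"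
  have "(norm (p - q))\<^sup>2 \<le> \<delta>\<^sup>2"
    using sqdist_antimono[OF A B BA, of v] inc by (simp add: p_def q_def)
  then have pq: "norm (p - q) \<le> \<delta>" using power2_le_imp_le[OF _ \<open>0 \<le> \<delta>\<close>] by blast
  have 1: "sqdist B v' \<le> (norm (v' - q))\<^sup>2"
    using nearest_Pythagoras[OF B nearest_mem[OF B, of v], of v']
      zero_le_power2[of "norm (nearest B v' - q)"] unfolding q_def by linarith
  have 2: "(norm (v' - q))\<^sup>2 = (norm (v - q))\<^sup>2 + 2 * ((v - q) \<bullet> (v' - v)) + (norm (v' - v))\<^sup>2"
    unfolding power2_norm_eq_inner by (simp add: inner_simps inner_commute)
  have "(v - p) \<bullet> (p' - p) \<le> 0"
    unfolding p_def p'_def using nearest_obtuse[OF A Ane nearest_mem[OF A Ane]] .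
  moreover have "(norm (v' - p'))\<^sup>2 = (norm (v - p))\<^sup>2 + 2 * ((v - p) \<bullet> (v' - v))
      - 2 * ((v - p) \<bullet> (p' - p)) + (norm ((v' - p') - (v - p)))\<^sup>2"
    unfolding power2_norm_eq_inner by (simp add: inner_simps inner_commute algebra_simps)
  ultimately have 3: "(norm (v - p))\<^sup>2 + 2 * ((v - p) \<bullet> (v' - v)) \<le> (norm (v' - p'))\<^sup>2"
    using zero_le_power2[of "norm ((v' - p') - (v - p))"] by linarith
  have "(p - q) \<bullet> (v' - v) \<le> \<delta> * norm (v' - v)"
    using norm_cauchy_schwarz[of "p - q" "v' - v"] pq mult_right_mono[OF pq norm_ge_zero[of "v' - v"]]
    by linarith
  moreover have "2 * (\<delta> * norm (v' - v)) \<le> \<delta>\<^sup>2 + (norm (v' - v))\<^sup>2"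
    using sum_squares_bound[of \<delta> "norm (v' - v)"] by (simp add: mult.assoc)
  ultimately show ?thesis
    using 1 2 3 inc by (simp add: p_def[symmetric] q_def[symmetric] p'_def[symmetric] inner_diff_left)
qed


section \<open>Averaged solutions of a variational inequality\<close>

text \<open>
  A weighted family of points \<open>t n\<close> of \<open>A\<close> that solves \<open>(G t - t) \<bullet> (q - t) \<le> 0\<close> on average, tested
  against all \<open>q\<close> in \<open>B\<close>. The two terms with \<open>\<kappa>\<close> come from discounting: a family obtained from
  a trajectory with end point \<open>x\<close> satisfies the inequality with the distance of \<open>x\<close> from \<open>q\<close> as an
  additional gain. This term turns statements about averages into statements about \<open>x\<close>.
\<close>

definition approx_solution ::
    "real \<Rightarrow> real \<Rightarrow> ('a::real_inner \<Rightarrow> 'a) \<Rightarrow> 'a set \<Rightarrow> 'a set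
      \<Rightarrow> nat set \<Rightarrow> (nat \<Rightarrow> real) \<Rightarrow> (nat \<Rightarrow> 'a) \<Rightarrow> 'a \<Rightarrow> bool"
  where "approx_solution \<kappa> \<eta> G A B I w t x \<longleftrightarrow>
    finite I \<and> (\<forall>n\<in>I. 0 \<le> w n \<and> t n \<in> A) \<and> sum w I = 1 \<and>
    (\<forall>q\<in>B. \<kappa> * (norm (x - q))\<^sup>2
        \<le> (\<Sum>n\<in>I. w n * (\<kappa> * (norm (t n - q))\<^sup>2 + 2 * ((G (t n) - t n) \<bullet> (t n - q)))) + \<eta>)"

lemma approx_solution_mono:
  "approx_solution \<kappa> \<eta> G A' B' I w t x \<Longrightarrow> A' \<subseteq> A \<Longrightarrow> B \<subseteq> B' \<Longrightarrow> approx_solution \<kappa> \<eta> G A B I w t x"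
  unfolding approx_solution_def by blast

text \<open>
  Let \<open>p\<close>, \<open>q\<close> be the points of \<open>A\<close>, \<open>B\<close> nearest to \<open>v\<close>. By Pythagoras,
  \<open>norm (p - t)\<close> squared is at most the difference of the squared distances from \<open>v\<close> to \<open>t\<close>
  and to \<open>q\<close>, plus \<open>\<delta>\<^sup>2\<close>. Written with \<open>v = G t + (v - G t)\<close>, this difference consists of the term
  tested by the variational inequality, a cross term and minus the squared distance from \<open>t\<close> to \<open>q\<close>, so that
  Young's inequality leaves room for the term with \<open>\<kappa>\<close>. The sequence of estimates never passes
  from \<open>p\<close> to \<open>q\<close> by the triangle inequality, which would cost an error linear in \<open>\<delta>\<close>.
\<close>

lemma approx_solution_step:
  fixes A B :: "'a::{real_inner, complete_space} set"
  assumes A: "closed A" "convex A" and B: "closed B" "convex B" "B \<noteq> {}" and BA: "B \<subseteq> A"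
    and \<kappa>: "0 < \<kappa>" "\<kappa> < 1"
    and inc: "sqdist B v - sqdist A v \<le> \<delta>\<^sup>2"
    and sol: "approx_solution \<kappa> \<eta> G A B I w t x"
  shows "(\<Sum>n\<in>I. w n * (norm (nearest A v - t n))\<^sup>2) + \<kappa> * (norm (x - nearest B v))\<^sup>2
    \<le> (\<Sum>n\<in>I. w n * (norm (v - G (t n)))\<^sup>2) / (1 - \<kappa>) + \<delta>\<^sup>2 + \<eta>"
proof -
  define p q where "p = nearest A v" and "q = nearest B v"
  have Ane: "A \<noteq> {}" using B BA by auto
  have w: "\<And>n. n \<in> I \<Longrightarrow> 0 \<le> w n \<and> t n \<in> A" "sum w I = 1" "finite I"
    using sol by (auto simp: approx_solution_def)
  have pt: "(norm (p - t n))\<^sup>2 \<le> (norm (v - G (t n)))\<^sup>2 / (1 - \<kappa>) + \<delta>\<^sup>2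
      - (\<kappa> * (norm (t n - q))\<^sup>2 + 2 * ((G (t n) - t n) \<bullet> (t n - q)))" if "n \<in> I" for n
  proof -
    let ?e = "v - G (t n)" and ?z = "q - t n"
    have "(norm (v - p))\<^sup>2 + (norm (p - t n))\<^sup>2 \<le> (norm (v - t n))\<^sup>2"
      unfolding p_def using nearest_Pythagoras[OF A Ane] w(1)[OF that] by blast
    moreover have "(norm (v - t n))\<^sup>2 - (norm (v - q))\<^sup>2
        = 2 * ((G (t n) - t n) \<bullet> ?z) - (norm ?z)\<^sup>2 + 2 * (?e \<bullet> ?z)"
      unfolding power2_norm_eq_inner by (simp add: inner_simps inner_commute algebra_simps)
    moreover have "2 * (?e \<bullet> ?z) \<le> (norm ?e)\<^sup>2 / (1 - \<kappa>) + (1 - \<kappa>) * (norm ?z)\<^sup>2"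
    proof -
      have "0 \<le> (norm (?e - (1 - \<kappa>) *\<^sub>R ?z))\<^sup>2 / (1 - \<kappa>)" using \<kappa> by simp
      also have "\<dots> = ((norm ?e)\<^sup>2 - 2 * (1 - \<kappa>) * (?e \<bullet> ?z) + (1 - \<kappa>)\<^sup>2 * (norm ?z)\<^sup>2) / (1 - \<kappa>)"
        unfolding power2_norm_eq_inner
        by (simp add: inner_diff_left inner_diff_right inner_commute power2_eq_square algebra_simps)
      also have "\<dots> = (norm ?e)\<^sup>2 / (1 - \<kappa>) - 2 * (?e \<bullet> ?z) + (1 - \<kappa>) * (norm ?z)\<^sup>2"
        using \<kappa> by (simp add: field_simps power2_eq_square)
      finally show ?thesis by simp
    qed
    moreover have "(G (t n) - t n) \<bullet> ?z = - ((G (t n) - t n) \<bullet> (t n - q))"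
      by (simp add: inner_diff_right)
    ultimately show ?thesis
      using inc by (simp add: p_def q_def norm_minus_commute algebra_simps)
  qed
  have "(\<Sum>n\<in>I. w n * (norm (p - t n))\<^sup>2) \<le> (\<Sum>n\<in>I. w n * ((norm (v - G (t n)))\<^sup>2 / (1 - \<kappa>) + \<delta>\<^sup>2
      - (\<kappa> * (norm (t n - q))\<^sup>2 + 2 * ((G (t n) - t n) \<bullet> (t n - q)))))"
    by (intro sum_mono mult_left_mono pt) (use w in auto)
  also have "\<dots> = (\<Sum>n\<in>I. w n * (norm (v - G (t n)))\<^sup>2) / (1 - \<kappa>) + \<delta>\<^sup>2
      - (\<Sum>n\<in>I. w n * (\<kappa> * (norm (t n - q))\<^sup>2 + 2 * ((G (t n) - t n) \<bullet> (t n - q))))"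
    by (simp only: distrib_left right_diff_distrib sum.distrib sum_subtractf sum_divide_distrib
        times_divide_eq_right w(2) flip: sum_distrib_right)
  also have "\<dots> \<le> (\<Sum>n\<in>I. w n * (norm (v - G (t n)))\<^sup>2) / (1 - \<kappa>) + \<delta>\<^sup>2 + (\<eta> - \<kappa> * (norm (x - q))\<^sup>2)"
  proof -
    have "q \<in> B" using nearest_mem[OF B] by (simp add: q_def)
    then show ?thesis using sol unfolding approx_solution_def by fastforce
  qed
  finally show ?thesis by (simp add: p_def q_def)
qed

section \<open>Searching a decreasing sequence of convex sets\<close>

lemma telescoping_pigeonhole:
  fixes f :: "nat \<Rightarrow> real"
  assumes "f (a + N * l) - f a \<le> real N * c" "0 < N"
  shows "\<exists>i<N. f (a + i * l + l) - f (a + i * l) \<le> c"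
proof (rule ccontr)
  assume "\<not> ?thesis"
  then have "(\<Sum>i<N. c) < (\<Sum>i<N. f (a + i * l + l) - f (a + i * l))"
    using assms(2) by (intro sum_strict_mono) auto
  also have "\<dots> = (\<Sum>i<N. f (a + Suc i * l) - f (a + i * l))"
    by (simp add: algebra_simps)
  also have "\<dots> = f (a + N * l) - f a"
    using sum_lessThan_telescope[of "\<lambda>i. f (a + i * l)" N] by simp
  finally show False using assms(1) by simp
qed

locale nested_convex_sets =
  fixes C :: "'a::{real_inner, complete_space} set"
    and G :: "'a \<Rightarrow> 'a" and \<tau> d :: real and K :: "nat \<Rightarrow> 'a set"
  assumes dist_le: "x \<in> C \<Longrightarrow> y \<in> C \<Longrightarrow> norm (x - y) \<le> d"
    and convex_C: "convex C"
    and G_mem: "x \<in> C \<Longrightarrow> G x \<in> C"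
    and G_lipschitz: "x \<in> C \<Longrightarrow> y \<in> C \<Longrightarrow> norm (G x - G y) \<le> \<tau> * norm (x - y)"
    and \<tau>: "0 \<le> \<tau>" "\<tau> < 1"
    and K: "closed (K n)" "convex (K n)" "K n \<noteq> {}" "K n \<subseteq> C"
    and K_antimono: "m \<le> n \<Longrightarrow> K n \<subseteq> K m"
begin

lemma sqdist_K_mono: "m \<le> n \<Longrightarrow> sqdist (K m) v \<le> sqdist (K n) v"
  using sqdist_antimono[OF K(1,2) K(1-3) K_antimono, of m n v]
    zero_le_power2[of "norm (nearest (K m) v - nearest (K n) v)"] by linarith

lemma nearest_K_mem: "nearest (K n) v \<in> C"
  using nearest_mem[OF K(1-3)] K(4) by blast

lemma stable_subinterval:
  assumes "sqdist (K b) v - sqdist (K a) v \<le> real N * c" "0 < N" "a + N * l \<le> b"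
  obtains a' where "a \<le> a'" "a' + l \<le> b" "sqdist (K (a' + l)) v - sqdist (K a') v \<le> c"
proof -
  have "sqdist (K (a + N * l)) v - sqdist (K a) v \<le> real N * c"
    using assms(1) sqdist_K_mono[OF assms(3), of v] by linarith
  then obtain i where i: "i < N" "sqdist (K (a + i * l + l)) v - sqdist (K (a + i * l)) v \<le> c"
    using telescoping_pigeonhole[where f="\<lambda>n. sqdist (K n) v", OF _ assms(2)] by blast
  have "i * l + l \<le> N * l" using i(1) mult_le_mono1[of "Suc i" N l] by simp
  then show ?thesis using i(2) assms(3) by (intro that[of "a + i * l"]) auto
qed

text \<open>
  Alternating this estimate with \<open>approx_solution_step\<close> makes the weighted mean of the squared distances
  from \<open>v\<close> to the points \<open>G (t n)\<close> decrease along the search.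
\<close>

lemma average_contraction:
  assumes sol: "approx_solution \<kappa> \<eta> G A B I w t x" and A: "A \<subseteq> C" and p: "p \<in> C"
  shows "(\<Sum>n\<in>I. w n * (norm (G p - G (t n)))\<^sup>2) \<le> \<tau>\<^sup>2 * (\<Sum>n\<in>I. w n * (norm (p - t n))\<^sup>2)"
proof -
  have "(\<Sum>n\<in>I. w n * (norm (G p - G (t n)))\<^sup>2) \<le> (\<Sum>n\<in>I. w n * (\<tau> * norm (p - t n))\<^sup>2)"
    using sol A p G_lipschitz \<tau>
    by (intro sum_mono mult_left_mono power_mono) (auto simp: approx_solution_def)
  then show ?thesis by (simp add: sum_distrib_left power_mult_distrib algebra_simps)
qed

lemma average_le_sq_diam:
  assumes sol: "approx_solution \<kappa> \<eta> G A B I w t x" and A: "A \<subseteq> C" and v: "v \<in> C"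
  shows "(\<Sum>n\<in>I. w n * (norm (v - t n))\<^sup>2) \<le> d\<^sup>2"
proof -
  have "(\<Sum>n\<in>I. w n * (norm (v - t n))\<^sup>2) \<le> (\<Sum>n\<in>I. w n * d\<^sup>2)"
    using sol A v dist_le by (intro sum_mono mult_left_mono power_mono) (auto simp: approx_solution_def)
  also have "\<dots> = d\<^sup>2" using sol by (simp add: approx_solution_def flip: sum_distrib_right)
  finally show ?thesis .
qed

lemma average_le_sq_diam_image:
  assumes sol: "approx_solution \<kappa> \<eta> G A B I w t x" and A: "A \<subseteq> C" and v: "v \<in> C"
  shows "(\<Sum>n\<in>I. w n * (norm (v - G (t n)))\<^sup>2) \<le> d\<^sup>2"
proof -
  have "(\<Sum>n\<in>I. w n * (norm (v - G (t n)))\<^sup>2) \<le> (\<Sum>n\<in>I. w n * d\<^sup>2)"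
    using sol A v dist_le G_mem
    by (intro sum_mono mult_left_mono power_mono) (auto simp: approx_solution_def)
  also have "\<dots> = d\<^sup>2" using sol by (simp add: approx_solution_def flip: sum_distrib_right)
  finally show ?thesis .
qed

lemma K_step:
  assumes "a \<le> b" "0 < \<kappa>" "\<kappa> < 1" "\<eta> \<le> \<delta>\<^sup>2"
    and "sqdist (K b) v - sqdist (K a) v \<le> \<delta>\<^sup>2"
    and "approx_solution \<kappa> \<eta> G (K a) (K b) I w t x"
  shows "(\<Sum>n\<in>I. w n * (norm (nearest (K a) v - t n))\<^sup>2) + \<kappa> * (norm (x - nearest (K b) v))\<^sup>2
    \<le> (\<Sum>n\<in>I. w n * (norm (v - G (t n)))\<^sup>2) / (1 - \<kappa>) + 2 * \<delta>\<^sup>2"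
  using approx_solution_step[OF K(1,2) K(1-3) K_antimono[OF assms(1)] assms(2,3,5,6)] assms(4)
  by linarith

text \<open>
  With \<open>\<tau> \<le> 1/2\<close> each level reduces the excess \<open>e\<close> over the noise \<open>\<delta>\<^sup>2\<close> by the factor \<open>\<tau>\<close>, since
  \<open>\<tau>\<^sup>2 / (1 - \<kappa>) \<le> \<tau>\<close> and the noise reproduces itself. A level costs a factor \<open>N\<close> in the length of the
  interval. The last level is used for the end points \<open>x\<close>.
\<close>

lemma Picard_search:
  assumes \<kappa>: "0 < \<kappa>" "\<kappa> \<le> 1/4" and \<tau>2: "\<tau> \<le> 1/2" and \<eta>: "\<eta> \<le> \<delta>\<^sup>2"
    and N: "0 < N" "d\<^sup>2 \<le> real N * \<delta>\<^sup>2"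
    and "v \<in> C" "a + N ^ (m + 1) \<le> b" "0 \<le> e"
    and "\<And>I w t x. approx_solution \<kappa> \<eta> G (K a) (K b) I w t x
      \<Longrightarrow> (\<Sum>n\<in>I. w n * (norm (v - G (t n)))\<^sup>2) \<le> e + \<delta>\<^sup>2"
  shows "\<exists>j Q. a \<le> j \<and> j < b \<and> (\<forall>I w t x. approx_solution \<kappa> \<eta> G (K j) (K (Suc j)) I w t x
      \<longrightarrow> \<kappa> * (norm (x - Q))\<^sup>2 \<le> 4/3 * (\<tau> ^ m * e + \<delta>\<^sup>2) + 2 * \<delta>\<^sup>2)"
  using assms(7-10)
proof (induction m arbitrary: v a b e)
  case (0 v a b e)
  have "sqdist (K b) v - sqdist (K a) v \<le> d\<^sup>2"
    using dist_le[OF 0(1) nearest_K_mem] power_mono[of _ d 2] zero_le_power2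
    by (smt (verit) norm_ge_zero)
  then have "sqdist (K b) v - sqdist (K a) v \<le> real N * \<delta>\<^sup>2" using N by linarith
  moreover have "a + N * 1 \<le> b" using 0(2) by simp
  ultimately obtain a' where a': "a \<le> a'" "a' + 1 \<le> b"
    "sqdist (K (a' + 1)) v - sqdist (K a') v \<le> \<delta>\<^sup>2"
    using stable_subinterval N(1) by blast
  have "\<kappa> * (norm (x - nearest (K (Suc a')) v))\<^sup>2 \<le> 4/3 * (\<tau> ^ 0 * e + \<delta>\<^sup>2) + 2 * \<delta>\<^sup>2"
    if sol: "approx_solution \<kappa> \<eta> G (K a') (K (Suc a')) I w t x" for I w t x
  proof -
    have "approx_solution \<kappa> \<eta> G (K a) (K b) I w t x"
      using approx_solution_mono[OF sol] K_antimono a' by simp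
    then have V: "(\<Sum>n\<in>I. w n * (norm (v - G (t n)))\<^sup>2) \<le> e + \<delta>\<^sup>2" by (rule 0(4))
    have "(\<Sum>n\<in>I. w n * (norm (v - G (t n)))\<^sup>2) / (1 - \<kappa>) \<le> (e + \<delta>\<^sup>2) / (3/4)"
      using V \<kappa> 0(3) by (intro frac_le) auto
    also have "\<dots> = 4/3 * e + 4/3 * \<delta>\<^sup>2" by simp
    finally have "(\<Sum>n\<in>I. w n * (norm (v - G (t n)))\<^sup>2) / (1 - \<kappa>) \<le> 4/3 * e + 4/3 * \<delta>\<^sup>2" .
    moreover have "(\<Sum>n\<in>I. w n * (norm (nearest (K a') v - t n))\<^sup>2) + \<kappa> * (norm (x - nearest (K (Suc a')) v))\<^sup>2
        \<le> (\<Sum>n\<in>I. w n * (norm (v - G (t n)))\<^sup>2) / (1 - \<kappa>) + 2 * \<delta>\<^sup>2"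
      by (rule K_step[OF _ \<kappa>(1) _ \<eta> _ sol]) (use a' \<kappa>(2) in auto)
    moreover have "0 \<le> (\<Sum>n\<in>I. w n * (norm (nearest (K a') v - t n))\<^sup>2)"
      using sol by (intro sum_nonneg) (auto simp: approx_solution_def)
    ultimately show ?thesis unfolding power_0 mult_1 distrib_left by linarith
  qed
  then show ?case using a' by (intro exI[of _ a'] exI[of _ "nearest (K (Suc a')) v"]) auto
next
  case (Suc m v a b e)
  have "sqdist (K b) v - sqdist (K a) v \<le> d\<^sup>2"
    using dist_le[OF Suc(2) nearest_K_mem] power_mono[of _ d 2] zero_le_power2
    by (smt (verit) norm_ge_zero)
  then have "sqdist (K b) v - sqdist (K a) v \<le> real N * \<delta>\<^sup>2" using N by linarith
  moreover have "a + N * N ^ (m + 1) \<le> b" using Suc(3) by simp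
  ultimately obtain a' where a': "a \<le> a'" "a' + N ^ (m + 1) \<le> b"
    "sqdist (K (a' + N ^ (m + 1))) v - sqdist (K a') v \<le> \<delta>\<^sup>2"
    using stable_subinterval N(1) by blast
  define b' p where "b' = a' + N ^ (m + 1)" and "p = nearest (K a') v"
  have pC: "p \<in> C" by (simp add: p_def nearest_K_mem)
  have "\<exists>j Q. a' \<le> j \<and> j < b' \<and> (\<forall>I w t x. approx_solution \<kappa> \<eta> G (K j) (K (Suc j)) I w t x
      \<longrightarrow> \<kappa> * (norm (x - Q))\<^sup>2 \<le> 4/3 * (\<tau> ^ m * (\<tau> * e) + \<delta>\<^sup>2) + 2 * \<delta>\<^sup>2)"
  proof (rule Suc.IH)
    show "G p \<in> C" using pC G_mem by blast
    show "a' + N ^ (m + 1) \<le> b'" by (simp add: b'_def)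
    show "0 \<le> \<tau> * e" using \<tau> Suc(4) by simp
    fix I w t x assume sol: "approx_solution \<kappa> \<eta> G (K a') (K b') I w t x"
    have "approx_solution \<kappa> \<eta> G (K a) (K b) I w t x"
      using approx_solution_mono[OF sol] K_antimono a' by (simp add: b'_def)
    then have V: "(\<Sum>n\<in>I. w n * (norm (v - G (t n)))\<^sup>2) \<le> e + \<delta>\<^sup>2" by (rule Suc(5))
    have "(\<Sum>n\<in>I. w n * (norm (v - G (t n)))\<^sup>2) / (1 - \<kappa>) \<le> (e + \<delta>\<^sup>2) / (3/4)"
      using V \<kappa> Suc(4) by (intro frac_le) auto
    also have "\<dots> = 4/3 * e + 4/3 * \<delta>\<^sup>2" by simp
    finally have "(\<Sum>n\<in>I. w n * (norm (v - G (t n)))\<^sup>2) / (1 - \<kappa>) \<le> 4/3 * e + 4/3 * \<delta>\<^sup>2" .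
    moreover have "(\<Sum>n\<in>I. w n * (norm (p - t n))\<^sup>2) + \<kappa> * (norm (x - nearest (K b') v))\<^sup>2
        \<le> (\<Sum>n\<in>I. w n * (norm (v - G (t n)))\<^sup>2) / (1 - \<kappa>) + 2 * \<delta>\<^sup>2"
      unfolding p_def by (rule K_step[OF _ \<kappa>(1) _ \<eta> _ sol]) (use a' \<kappa>(2) in \<open>auto simp: b'_def\<close>)
    moreover have "0 \<le> \<kappa> * (norm (x - nearest (K b') v))\<^sup>2" using \<kappa> by simp
    ultimately have E: "(\<Sum>n\<in>I. w n * (norm (p - t n))\<^sup>2) \<le> 4/3 * e + 10/3 * \<delta>\<^sup>2"
      by linarith
    have "(\<Sum>n\<in>I. w n * (norm (G p - G (t n)))\<^sup>2) \<le> \<tau>\<^sup>2 * (\<Sum>n\<in>I. w n * (norm (p - t n))\<^sup>2)"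
      by (rule average_contraction[OF sol K(4) pC])
    also have "\<dots> \<le> \<tau>\<^sup>2 * (4/3 * e + 10/3 * \<delta>\<^sup>2)" by (intro mult_left_mono E) simp
    also have "\<dots> = (\<tau> * 4/3) * (\<tau> * e) + (\<tau> * \<tau>) * (10/3 * \<delta>\<^sup>2)"
      by (simp add: power2_eq_square algebra_simps)
    also have "\<dots> \<le> 1 * (\<tau> * e) + (1/2 * (1/2)) * (10/3 * \<delta>\<^sup>2)"
      using \<tau> \<tau>2 Suc(4) by (intro add_mono mult_right_mono mult_mono) auto
    also have "\<dots> \<le> \<tau> * e + \<delta>\<^sup>2" by simp
    finally show "(\<Sum>n\<in>I. w n * (norm (G p - G (t n)))\<^sup>2) \<le> \<tau> * e + \<delta>\<^sup>2" .
  qed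
  then obtain j Q where "a' \<le> j" "j < b'" "\<forall>I w t x. approx_solution \<kappa> \<eta> G (K j) (K (Suc j)) I w t x
      \<longrightarrow> \<kappa> * (norm (x - Q))\<^sup>2 \<le> 4/3 * (\<tau> ^ m * (\<tau> * e) + \<delta>\<^sup>2) + 2 * \<delta>\<^sup>2" by blast
  then show ?case using a' by (intro exI[of _ j] exI[of _ Q]) (auto simp: b'_def mult_ac)
qed

text \<open>
  The midpoint \<open>v'\<close> gains \<open>norm (v' - v)\<close> squared by the parallelogram law. This gain pays for
  the subdivision that the step from \<open>v\<close> to \<open>v'\<close> makes necessary. The value of \<open>\<kappa>\<close> is small enough for
  the mean to be contracted still by \<open>1 - (1 - \<tau>) / 4\<close>, and large enough for the coefficient of the
  gain at \<open>x\<close> to be of the order of \<open>1 - \<tau>\<close> as well.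
\<close>

lemma averaged_step:
  assumes "a \<le> b" and \<tau>2: "1/2 \<le> \<tau>" and \<eta>: "\<eta> \<le> \<delta>\<^sup>2"
    and inc: "sqdist (K b) v - sqdist (K a) v \<le> \<delta>\<^sup>2"
    and sol: "approx_solution ((1 - \<tau>) / 4) \<eta> G (K a) (K b) I w t x"
    and v': "v' = (1/2) *\<^sub>R v + (1/2) *\<^sub>R G (nearest (K a) v)"
  shows "(\<Sum>n\<in>I. w n * (norm (v' - G (t n)))\<^sup>2)
    \<le> (1 - (1 - \<tau>) / 4) * (\<Sum>n\<in>I. w n * (norm (v - G (t n)))\<^sup>2) + \<delta>\<^sup>2 - (norm (v' - v))\<^sup>2
      - (1 - \<tau>) / 32 * (norm (x - nearest (K b) v))\<^sup>2"
proof -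
  define p \<kappa> where "p = nearest (K a) v" and "\<kappa> = (1 - \<tau>) / 4"
  let ?V = "\<Sum>n\<in>I. w n * (norm (v - G (t n)))\<^sup>2"
  let ?E = "\<Sum>n\<in>I. w n * (norm (p - t n))\<^sup>2"
  let ?x = "(norm (x - nearest (K b) v))\<^sup>2"
  have \<kappa>: "0 < \<kappa>" "\<kappa> < 1" using \<tau> by (auto simp: \<kappa>_def)
  have w: "\<And>n. n \<in> I \<Longrightarrow> 0 \<le> w n" "sum w I = 1" using sol by (auto simp: approx_solution_def)
  have V0: "0 \<le> ?V" by (intro sum_nonneg mult_nonneg_nonneg w) auto
  have E: "?E \<le> ?V / (1 - \<kappa>) + 2 * \<delta>\<^sup>2 - \<kappa> * ?x"
    using K_step[OF \<open>a \<le> b\<close> \<kappa> \<eta> inc sol[folded \<kappa>_def]] unfolding p_def by linarith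
  have id: "(norm (v' - G (t n)))\<^sup>2
      = 1/2 * (norm (v - G (t n)))\<^sup>2 + 1/2 * (norm (G p - G (t n)))\<^sup>2 - (norm (v' - v))\<^sup>2" for n
    unfolding v' p_def[symmetric] power2_norm_eq_inner by (simp add: inner_simps inner_commute algebra_simps)
  have "(\<Sum>n\<in>I. w n * (norm (v' - G (t n)))\<^sup>2)
      = 1/2 * ?V + 1/2 * (\<Sum>n\<in>I. w n * (norm (G p - G (t n)))\<^sup>2) - (\<Sum>n\<in>I. w n * (norm (v' - v))\<^sup>2)"
    unfolding id by (simp add: sum_distrib_left sum.distrib sum_subtractf algebra_simps)
  also have "(\<Sum>n\<in>I. w n * (norm (v' - v))\<^sup>2) = (norm (v' - v))\<^sup>2"
    by (simp add: w(2) flip: sum_distrib_right)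
  also have "(\<Sum>n\<in>I. w n * (norm (G p - G (t n)))\<^sup>2) \<le> \<tau>\<^sup>2 * ?E"
    by (rule average_contraction[OF sol K(4)]) (simp add: p_def nearest_K_mem)
  also have "\<tau>\<^sup>2 * ?E \<le> \<tau>\<^sup>2 * (?V / (1 - \<kappa>) + 2 * \<delta>\<^sup>2 - \<kappa> * ?x)" by (intro mult_left_mono E) simp
  finally have main: "(\<Sum>n\<in>I. w n * (norm (v' - G (t n)))\<^sup>2) \<le> 1/2 * ?V
      + 1/2 * (\<tau>\<^sup>2 / (1 - \<kappa>) * ?V) + \<tau>\<^sup>2 * \<delta>\<^sup>2 - 1/2 * (\<tau>\<^sup>2 * \<kappa> * ?x) - (norm (v' - v))\<^sup>2"
    by (simp add: algebra_simps)
  have "\<tau>\<^sup>2 / (1 - \<kappa>) \<le> 1 - (1 - \<tau>) / 2"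
  proof -
    have "0 \<le> (1 - \<tau>) * (10 - 7 * (1 - \<tau>))" using \<tau> by (intro mult_nonneg_nonneg) auto
    then have "\<tau>\<^sup>2 \<le> (1 - (1 - \<tau>) / 2) * (1 - \<kappa>)"
      unfolding \<kappa>_def by (simp add: field_simps power2_eq_square)
    then show ?thesis using \<kappa> by (simp add: pos_divide_le_eq)
  qed
  then have 1: "\<tau>\<^sup>2 / (1 - \<kappa>) * ?V \<le> (1 - (1 - \<tau>) / 2) * ?V" using V0 by (rule mult_right_mono)
  have 2: "\<tau>\<^sup>2 * \<delta>\<^sup>2 \<le> \<delta>\<^sup>2" using \<tau> by (intro mult_left_le_one_le) (auto simp: power_le_one)
  have "1/4 \<le> \<tau>\<^sup>2" using power_mono[OF \<tau>2, of 2] by (simp add: power2_eq_square)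
  then have "1/4 * (\<kappa> * ?x) \<le> \<tau>\<^sup>2 * (\<kappa> * ?x)" using \<kappa> by (intro mult_right_mono) auto
  then have 3: "1/4 * \<kappa> * ?x \<le> \<tau>\<^sup>2 * \<kappa> * ?x" by (simp only: mult.assoc)
  have "1/2 * (1/4 * \<kappa> * ?x) = (1 - \<tau>) / 32 * ?x" by (simp add: \<kappa>_def)
  moreover have "1/2 * ?V + 1/2 * ((1 - (1 - \<tau>) / 2) * ?V) = (1 - (1 - \<tau>) / 4) * ?V"
    by (simp add: field_simps)
  ultimately show ?thesis using main 1 2 3 by linarith
qed

end

lemma sq_norm_convex_combination:
  fixes x y z :: "'a::real_inner"
  assumes "0 \<le> a" "0 \<le> b" "0 < a + b"
  shows "(a + b) * (norm (x - (1 / (a + b)) *\<^sub>R (a *\<^sub>R y + b *\<^sub>R z)))\<^sup>2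
    \<le> a * (norm (x - y))\<^sup>2 + b * (norm (x - z))\<^sup>2"
proof -
  define s where "s = a / (a + b)"
  have b: "b / (a + b) = 1 - s" using assms by (simp add: s_def field_simps)
  have s: "0 \<le> s" "s \<le> 1" using assms by (auto simp: s_def)
  have eq: "(1 / (a + b)) *\<^sub>R (a *\<^sub>R y + b *\<^sub>R z) = s *\<^sub>R y + (1 - s) *\<^sub>R z"
    using b by (simp add: s_def scaleR_right_distrib)
  have "(norm (x - (s *\<^sub>R y + (1 - s) *\<^sub>R z)))\<^sup>2
      = s * (norm (x - y))\<^sup>2 + (1 - s) * (norm (x - z))\<^sup>2 - s * (1 - s) * (norm (y - z))\<^sup>2"
    unfolding power2_norm_eq_inner by (simp add: inner_simps inner_commute algebra_simps)
  then have "(norm (x - (s *\<^sub>R y + (1 - s) *\<^sub>R z)))\<^sup>2 \<le> s * (norm (x - y))\<^sup>2 + (1 - s) * (norm (x - z))\<^sup>2"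
    using s by simp
  then have "(a + b) * (norm (x - (s *\<^sub>R y + (1 - s) *\<^sub>R z)))\<^sup>2
      \<le> (a + b) * (s * (norm (x - y))\<^sup>2 + (1 - s) * (norm (x - z))\<^sup>2)"
    using assms by (intro mult_left_mono) auto
  also have "\<dots> = (a + b) * s * (norm (x - y))\<^sup>2 + (a + b) * (1 - s) * (norm (x - z))\<^sup>2"
    by (simp add: algebra_simps)
  also have "(a + b) * s = a" using assms by (simp add: s_def)
  also have "(a + b) * (1 - s) = b" using assms unfolding b[symmetric] by simp
  finally show ?thesis by (simp only: eq)
qed

context nested_convex_sets
begin

text \<open>
  \<open>W\<close> is a budget for the sum of the squared step lengths \<open>r\<^sup>2\<close>: every level adds at most \<open>\<delta>\<^sup>2\<close> to it
  and removes \<open>r\<^sup>2\<close>. A step of length \<open>r\<close> needs at most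
  \<open>6 + 4 (r / \<delta>)\<^sup>2\<close> times the length that is required afterwards (roundings included), and this factor is
  absorbed by \<open>X\<close> and the change of the exponential. In this way the
  cost is that of the mean of the \<open>(r / \<delta>)\<^sup>2\<close> over all levels, not that of the largest one. The point \<open>Q\<close> is a
  weighted mean of the nearest points met at all levels, with weights that undo the contraction, so that the gains
  at \<open>x\<close> of all levels add up to a bound on the distance from \<open>x\<close> to \<open>Q\<close>.
\<close>

lemma averaged_search:
  fixes m :: nat
  assumes \<tau>2: "1/2 \<le> \<tau>" and \<eta>: "\<eta> \<le> \<delta>\<^sup>2" and \<delta>: "0 < \<delta>" and X: "18 \<le> X"
    and "v \<in> C" and "sqdist (K b) v - sqdist (K a) v \<le> \<delta>\<^sup>2"
    and "X ^ m * exp (12 * W / (X * \<delta>\<^sup>2)) \<le> real b - real a"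
    and "\<And>I w t x. approx_solution ((1 - \<tau>) / 4) \<eta> G (K a) (K b) I w t x
      \<Longrightarrow> (\<Sum>n\<in>I. w n * (norm (v - G (t n)))\<^sup>2) \<le> W"
  shows "\<exists>j Q. a \<le> j \<and> j < b \<and> (\<forall>I w t x. approx_solution ((1 - \<tau>) / 4) \<eta> G (K j) (K (Suc j)) I w t x
      \<longrightarrow> (1 - \<tau>) / 32 * (\<Sum>i<m. (1 - (1 - \<tau>) / 4) ^ i) * (norm (x - Q))\<^sup>2
        \<le> (1 - (1 - \<tau>) / 4) ^ m * (\<Sum>n\<in>I. w n * (norm (v - G (t n)))\<^sup>2)
          + \<delta>\<^sup>2 * (\<Sum>i<m. (1 - (1 - \<tau>) / 4) ^ i))"
  using assms(5-8)
proof (induction m arbitrary: v a b W)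
  case (0 v a b W)
  have "0 < real b - real a" using 0(3) exp_gt_zero[of "12 * W / (X * \<delta>\<^sup>2)"] unfolding power_0 mult_1 by linarith
  moreover have "0 \<le> (\<Sum>n\<in>I. w n * (norm (v - G (t n)))\<^sup>2)"
    if "approx_solution ((1 - \<tau>) / 4) \<eta> G (K a) (K (Suc a)) I w t x" for I w t x
    using that by (intro sum_nonneg) (auto simp: approx_solution_def)
  ultimately show ?case by (intro exI[of _ a]) auto
next
  case (Suc m v a b W)
  define \<kappa> y where "\<kappa> = (1 - \<tau>) / 4" and "y = 1 - \<kappa>"
  have y: "0 < y" using \<tau> by (simp add: y_def \<kappa>_def)
  define v' where "v' = (\<lambda>a. (1/2) *\<^sub>R v + (1/2) *\<^sub>R G (nearest (K a) v))"
  define r W' where "r = norm (v' a - v)" and "W' = W + \<delta>\<^sup>2 - r\<^sup>2"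
  have "0 < X ^ Suc m * exp (12 * W / (X * \<delta>\<^sup>2))" using X by simp
  then have ab: "a < b" using Suc(4) by linarith
  have v'C: "v' a \<in> C"
    using convexD[OF convex_C Suc(2) G_mem[OF nearest_K_mem]] by (simp add: v'_def)
  have step: "(\<Sum>n\<in>I. w n * (norm (v' a - G (t n)))\<^sup>2)
    \<le> y * (\<Sum>n\<in>I. w n * (norm (v - G (t n)))\<^sup>2) + \<delta>\<^sup>2 - r\<^sup>2
      - (1 - \<tau>) / 32 * (norm (x - nearest (K b) v))\<^sup>2"
    if "approx_solution ((1 - \<tau>) / 4) \<eta> G (K a) (K b) I w t x" for I w t x
    using averaged_step[OF less_imp_le[OF ab] \<tau>2 \<eta> Suc(3) that, of "v' a"]
    by (simp add: v'_def r_def y_def \<kappa>_def)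
  have bound: "(\<Sum>n\<in>I. w n * (norm (v' a - G (t n)))\<^sup>2) \<le> W'"
    if sol: "approx_solution ((1 - \<tau>) / 4) \<eta> G (K a) (K b) I w t x" for I w t x
  proof -
    have "0 \<le> (\<Sum>n\<in>I. w n * (norm (v - G (t n)))\<^sup>2)"
      using sol by (intro sum_nonneg) (auto simp: approx_solution_def)
    then have "y * (\<Sum>n\<in>I. w n * (norm (v - G (t n)))\<^sup>2) \<le> 1 * (\<Sum>n\<in>I. w n * (norm (v - G (t n)))\<^sup>2)"
      using \<tau> by (intro mult_right_mono) (auto simp: y_def \<kappa>_def)
    moreover have "0 \<le> (1 - \<tau>) / 32 * (norm (x - nearest (K b) v))\<^sup>2" using \<tau> by simp
    ultimately show ?thesis using step[OF sol] Suc(5)[OF sol] by (simp add: W'_def)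
  qed
  show ?case
  proof (cases "W' < 0")
    case True
    \<comment> \<open>An exhausted budget means that there is no averaged solution at all.\<close>
    have "\<not> approx_solution ((1 - \<tau>) / 4) \<eta> G (K a) (K (Suc a)) I w t x" for I w t x
    proof
      assume "approx_solution ((1 - \<tau>) / 4) \<eta> G (K a) (K (Suc a)) I w t x"
      then have sol: "approx_solution ((1 - \<tau>) / 4) \<eta> G (K a) (K b) I w t x"
        by (rule approx_solution_mono) (use ab K_antimono in auto)
      then have "0 \<le> (\<Sum>n\<in>I. w n * (norm (v' a - G (t n)))\<^sup>2)"
        by (intro sum_nonneg) (auto simp: approx_solution_def)
      then show False using bound[OF sol] True by linarith
    qed
    then show ?thesis using ab by blast
  next
    case False
    \<comment> \<open>Rounding up to \<open>l\<close> at most doubles \<open>L\<close>, because \<open>1 \<le> L\<close>.\<close>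
    define L where "L = X ^ m * exp (12 * W' / (X * \<delta>\<^sup>2))"
    define l N where "l = nat \<lceil>L\<rceil>" and "N = nat \<lceil>2 + 2 * r\<^sup>2 / \<delta>\<^sup>2\<rceil>"
    have "1 \<le> X ^ m" using X by (intro one_le_power) auto
    moreover have "1 \<le> exp (12 * W' / (X * \<delta>\<^sup>2))" using False X \<delta> by simp
    ultimately have L1: "1 * 1 \<le> L" unfolding L_def by (intro mult_mono) auto
    have l: "L \<le> real l" "real l \<le> 2 * L" using L1 by (auto simp: l_def) linarith+
    have N: "2 + 2 * r\<^sup>2 / \<delta>\<^sup>2 \<le> real N" "real N \<le> 3 + 2 * r\<^sup>2 / \<delta>\<^sup>2"
    proof -
      have "0 \<le> r\<^sup>2 / \<delta>\<^sup>2" by simp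
      then show "2 + 2 * r\<^sup>2 / \<delta>\<^sup>2 \<le> real N" "real N \<le> 3 + 2 * r\<^sup>2 / \<delta>\<^sup>2"
        unfolding N_def by linarith+
    qed
    have N0: "0 < N" using N(1) divide_nonneg_nonneg[OF zero_le_power2[of r] zero_le_power2[of \<delta>]] by (cases N) auto
    have "real N * real l \<le> (3 + 2 * r\<^sup>2 / \<delta>\<^sup>2) * (2 * L)"
      using N l L1 by (intro mult_mono) auto
    also have "\<dots> = (6 + 4 * (r\<^sup>2 / \<delta>\<^sup>2)) * L" by (simp add: algebra_simps)
    also have "\<dots> \<le> (X * exp (12 / X * (r\<^sup>2 / \<delta>\<^sup>2 - 1))) * L"
    proof (rule mult_right_mono)
      have "6 + 4 * (r\<^sup>2 / \<delta>\<^sup>2) \<le> X - 12 + 12 * (r\<^sup>2 / \<delta>\<^sup>2)"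
        using X divide_nonneg_nonneg[OF zero_le_power2[of r] zero_le_power2[of \<delta>]] by linarith
      also have "\<dots> = X * (1 + 12 / X * (r\<^sup>2 / \<delta>\<^sup>2 - 1))" using X by (simp add: field_simps)
      also have "\<dots> \<le> X * exp (12 / X * (r\<^sup>2 / \<delta>\<^sup>2 - 1))"
        using X by (intro mult_left_mono exp_ge_add_one_self) auto
      finally show "6 + 4 * (r\<^sup>2 / \<delta>\<^sup>2) \<le> X * exp (12 / X * (r\<^sup>2 / \<delta>\<^sup>2 - 1))" .
    qed (use L1 in simp)
    also have "\<dots> = X ^ Suc m * (exp (12 / X * (r\<^sup>2 / \<delta>\<^sup>2 - 1)) * exp (12 * W' / (X * \<delta>\<^sup>2)))"
      by (simp add: L_def)
    also have "\<dots> = X ^ Suc m * exp (12 * W / (X * \<delta>\<^sup>2))"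
    proof -
      have "12 / X * (r\<^sup>2 / \<delta>\<^sup>2 - 1) + 12 * W' / (X * \<delta>\<^sup>2) = 12 * W / (X * \<delta>\<^sup>2)"
        using X \<delta> by (simp add: W'_def field_simps)
      then show ?thesis by (simp flip: exp_add)
    qed
    also have "\<dots> \<le> real b - real a" by (rule Suc(4))
    finally have "real (a + N * l) \<le> real b" by simp
    then have fits: "a + N * l \<le> b" by (simp only: of_nat_le_iff)
    have "sqdist (K b) (v' a) - sqdist (K a) (v' a) \<le> 2 * \<delta>\<^sup>2 + 2 * r\<^sup>2"
      unfolding r_def
      by (rule sqdist_increment_perturb[OF K(1,2) K(1-3) K_antimono Suc(3)]) (use ab \<delta> in auto)
    also have "\<dots> = (2 + 2 * r\<^sup>2 / \<delta>\<^sup>2) * \<delta>\<^sup>2" using \<delta> by (simp add: field_simps)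
    also have "\<dots> \<le> real N * \<delta>\<^sup>2" by (intro mult_right_mono N) simp
    finally obtain a' where a': "a \<le> a'" "a' + l \<le> b"
      "sqdist (K (a' + l)) (v' a) - sqdist (K a') (v' a) \<le> \<delta>\<^sup>2"
      using stable_subinterval N0 fits by blast
    define b' where "b' = a' + l"
    have sub: "approx_solution ((1 - \<tau>) / 4) \<eta> G (K a) (K b) I w t x"
      if "approx_solution ((1 - \<tau>) / 4) \<eta> G (K a1) (K b1) I w t x" "a' \<le> a1" "b1 \<le> b'" for I w t x a1 b1
      by (rule approx_solution_mono[OF that(1)]) (use a' that K_antimono in \<open>auto simp: b'_def\<close>)
    have "\<exists>j Q. a' \<le> j \<and> j < b' \<and> (\<forall>I w t x. approx_solution ((1 - \<tau>) / 4) \<eta> G (K j) (K (Suc j)) I w t x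
      \<longrightarrow> (1 - \<tau>) / 32 * (\<Sum>i<m. (1 - (1 - \<tau>) / 4) ^ i) * (norm (x - Q))\<^sup>2
        \<le> (1 - (1 - \<tau>) / 4) ^ m * (\<Sum>n\<in>I. w n * (norm (v' a - G (t n)))\<^sup>2)
          + \<delta>\<^sup>2 * (\<Sum>i<m. (1 - (1 - \<tau>) / 4) ^ i))"
    proof (rule Suc.IH)
      show "v' a \<in> C" by (rule v'C)
      show "sqdist (K b') (v' a) - sqdist (K a') (v' a) \<le> \<delta>\<^sup>2" using a'(3) by (simp add: b'_def)
      show "X ^ m * exp (12 * W' / (X * \<delta>\<^sup>2)) \<le> real b' - real a'" using l(1) by (simp add: b'_def L_def)
      show "(\<Sum>n\<in>I. w n * (norm (v' a - G (t n)))\<^sup>2) \<le> W'"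
        if "approx_solution ((1 - \<tau>) / 4) \<eta> G (K a') (K b') I w t x" for I w t x
        using bound sub[OF that] by simp
    qed
    then obtain j Q where j: "a' \<le> j" "j < b'" and Q: "\<And>I w t x.
        approx_solution ((1 - \<tau>) / 4) \<eta> G (K j) (K (Suc j)) I w t x
      \<Longrightarrow> (1 - \<tau>) / 32 * (\<Sum>i<m. y ^ i) * (norm (x - Q))\<^sup>2
        \<le> y ^ m * (\<Sum>n\<in>I. w n * (norm (v' a - G (t n)))\<^sup>2) + \<delta>\<^sup>2 * (\<Sum>i<m. y ^ i)"
      unfolding y_def \<kappa>_def by blast
    define S q Q' where "S = (\<Sum>i<m. y ^ i)" and "q = nearest (K b) v"
      and "Q' = (1 / (y ^ m + S)) *\<^sub>R (y ^ m *\<^sub>R q + S *\<^sub>R Q)"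
    have S: "0 \<le> S" "0 < y ^ m" using y by (auto simp: S_def intro: sum_nonneg)
    have "(1 - \<tau>) / 32 * (\<Sum>i<Suc m. y ^ i) * (norm (x - Q'))\<^sup>2
        \<le> y ^ Suc m * (\<Sum>n\<in>I. w n * (norm (v - G (t n)))\<^sup>2) + \<delta>\<^sup>2 * (\<Sum>i<Suc m. y ^ i)"
      if sol: "approx_solution ((1 - \<tau>) / 4) \<eta> G (K j) (K (Suc j)) I w t x" for I w t x
    proof -
      let ?V = "\<Sum>n\<in>I. w n * (norm (v - G (t n)))\<^sup>2"
      let ?V' = "\<Sum>n\<in>I. w n * (norm (v' a - G (t n)))\<^sup>2"
      have "(y ^ m + S) * (norm (x - Q'))\<^sup>2 \<le> y ^ m * (norm (x - q))\<^sup>2 + S * (norm (x - Q))\<^sup>2"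
        unfolding Q'_def by (rule sq_norm_convex_combination) (use S in auto)
      then have "(1 - \<tau>) / 32 * ((y ^ m + S) * (norm (x - Q'))\<^sup>2)
          \<le> (1 - \<tau>) / 32 * (y ^ m * (norm (x - q))\<^sup>2 + S * (norm (x - Q))\<^sup>2)"
        using \<tau> by (intro mult_left_mono) auto
      also have "\<dots> = y ^ m * ((1 - \<tau>) / 32 * (norm (x - q))\<^sup>2) + (1 - \<tau>) / 32 * S * (norm (x - Q))\<^sup>2"
        by (simp only: distrib_left mult_ac)
      also have "(1 - \<tau>) / 32 * S * (norm (x - Q))\<^sup>2 \<le> y ^ m * ?V' + \<delta>\<^sup>2 * S"
        using Q[OF sol] by (simp add: S_def)
      also have "y ^ m * ?V' \<le> y ^ m * (y * ?V + \<delta>\<^sup>2 - (1 - \<tau>) / 32 * (norm (x - q))\<^sup>2)"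
      proof (rule mult_left_mono)
        have sol': "approx_solution ((1 - \<tau>) / 4) \<eta> G (K a) (K b) I w t x" using sub[OF sol] j by simp
        show "?V' \<le> y * ?V + \<delta>\<^sup>2 - (1 - \<tau>) / 32 * (norm (x - q))\<^sup>2"
          using step[OF sol'] zero_le_power2[of r] unfolding q_def by linarith
      qed (use S in simp)
      finally have fin: "(1 - \<tau>) / 32 * ((y ^ m + S) * (norm (x - Q'))\<^sup>2)
          \<le> y ^ m * ((1 - \<tau>) / 32 * (norm (x - q))\<^sup>2)
            + (y ^ m * (y * ?V + \<delta>\<^sup>2 - (1 - \<tau>) / 32 * (norm (x - q))\<^sup>2) + \<delta>\<^sup>2 * S)" by simp
      define c where "c = (1 - \<tau>) / 32"
      have sum: "(\<Sum>i<Suc m. y ^ i) = y ^ m + S" by (simp add: S_def)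
      show ?thesis
        using fin unfolding sum c_def[symmetric] by (simp add: algebra_simps)
    qed
    then show ?thesis
      using j a' unfolding y_def \<kappa>_def b'_def by (intro exI[of _ j] exI[of _ Q']) auto
  qed
qed

end

context nested_convex_sets
begin

text \<open>
  The search starts at \<open>G v\<close> for an arbitrary \<open>v\<close> in \<open>C\<close>, which already contributes one factor \<open>\<tau>\<close>;
  therefore \<open>m + 1\<close> subdivisions give the contraction \<open>\<tau> ^ (m + 1)\<close>.
\<close>

lemma stable_index_Picard:
  assumes \<tau>2: "\<tau> \<le> 1/2" and e: "0 < e" and \<eta>: "\<eta> \<le> (1 - \<tau>) * e\<^sup>2 / 16"
    and N: "0 < N" "32 * (d\<^sup>2 / e\<^sup>2) \<le> real N"
    and m: "\<tau> ^ Suc m * d\<^sup>2 \<le> (1 - \<tau>) * e\<^sup>2 / 16"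
  shows "\<exists>j < N ^ (m + 1). \<exists>Q. \<forall>I w t x. approx_solution ((1 - \<tau>) / 4) \<eta> G (K j) (K (Suc j)) I w t x
    \<longrightarrow> norm (x - Q) \<le> 2 * e"
proof -
  define \<delta> \<kappa> where "\<delta> = sqrt ((1 - \<tau>) * e\<^sup>2 / 16)" and "\<kappa> = (1 - \<tau>) / 4"
  have \<delta>2: "\<delta>\<^sup>2 = (1 - \<tau>) * e\<^sup>2 / 16" using \<tau> by (simp add: \<delta>_def)
  have \<kappa>: "0 < \<kappa>" "\<kappa> \<le> 1/4" using \<tau> by (auto simp: \<kappa>_def)
  have "1/2 * e\<^sup>2 \<le> (1 - \<tau>) * e\<^sup>2" using \<tau>2 by (intro mult_right_mono) auto
  then have d2: "e\<^sup>2 / 32 \<le> \<delta>\<^sup>2" by (simp add: \<delta>2)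
  have "d\<^sup>2 = 32 * (d\<^sup>2 / e\<^sup>2) * (e\<^sup>2 / 32)" using e by simp
  also have "\<dots> \<le> real N * \<delta>\<^sup>2" using N d2 by (intro mult_mono) auto
  finally have N2: "d\<^sup>2 \<le> real N * \<delta>\<^sup>2" .
  obtain v where v: "v \<in> C" using K(3,4) by blast
  have init: "(\<Sum>n\<in>I. w n * (norm (G v - G (t n)))\<^sup>2) \<le> \<tau> * d\<^sup>2 + \<delta>\<^sup>2"
    if sol: "approx_solution \<kappa> \<eta> G (K 0) (K (N ^ (m + 1))) I w t x" for I w t x
  proof -
    have "(\<Sum>n\<in>I. w n * (norm (G v - G (t n)))\<^sup>2) \<le> \<tau>\<^sup>2 * (\<Sum>n\<in>I. w n * (norm (v - t n))\<^sup>2)"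
      by (rule average_contraction[OF sol K(4) v])
    also have "\<dots> \<le> \<tau>\<^sup>2 * d\<^sup>2" by (intro mult_left_mono average_le_sq_diam[OF sol K(4) v]) simp
    also have "\<dots> \<le> \<tau> * d\<^sup>2"
      using \<tau> by (intro mult_right_mono) (auto simp: power2_eq_square mult_left_le_one_le)
    finally show ?thesis using zero_le_power2[of \<delta>] by linarith
  qed
  obtain j Q where j: "j < N ^ (m + 1)" and Q: "\<And>I w t x. approx_solution \<kappa> \<eta> G (K j) (K (Suc j)) I w t x
      \<Longrightarrow> \<kappa> * (norm (x - Q))\<^sup>2 \<le> 4/3 * (\<tau> ^ m * (\<tau> * d\<^sup>2) + \<delta>\<^sup>2) + 2 * \<delta>\<^sup>2"
    using Picard_search[OF \<kappa> \<tau>2 _ N(1) N2 G_mem[OF v], of \<eta> 0 m "N ^ (m + 1)" "\<tau> * d\<^sup>2"] \<eta> \<tau> init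
    by (auto simp: \<delta>2)
  have "norm (x - Q) \<le> 2 * e" if "approx_solution \<kappa> \<eta> G (K j) (K (Suc j)) I w t x" for I w t x
  proof -
    have "\<kappa> * (norm (x - Q))\<^sup>2 \<le> 4/3 * (\<delta>\<^sup>2 + \<delta>\<^sup>2) + 2 * \<delta>\<^sup>2"
    proof -
      have "\<tau> ^ m * (\<tau> * d\<^sup>2) \<le> \<delta>\<^sup>2" using m by (simp add: \<delta>2 mult_ac)
      then have "4/3 * (\<tau> ^ m * (\<tau> * d\<^sup>2) + \<delta>\<^sup>2) \<le> 4/3 * (\<delta>\<^sup>2 + \<delta>\<^sup>2)"
        by (intro mult_left_mono) auto
      then show ?thesis using Q[OF that] by linarith
    qed
    also have "\<dots> = \<kappa> * (7 / 6 * e\<^sup>2)" unfolding \<delta>2 \<kappa>_def by (simp add: field_simps)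
    finally have "(norm (x - Q))\<^sup>2 \<le> 7 / 6 * e\<^sup>2" using \<kappa> by (simp only: mult_le_cancel_left_pos)
    also have "\<dots> \<le> (2 * e)\<^sup>2" by (simp add: power_mult_distrib)
    finally show ?thesis using e by (intro power2_le_imp_le[of "norm (x - Q)"]) auto
  qed
  then show ?thesis using j unfolding \<kappa>_def by blast
qed

text \<open>
  The search starts at a point of the smallest set, where all squared distances vanish, so that no
  subdivision is needed before the first step. The choice \<open>X = 192 d\<^sup>2 / e\<^sup>2\<close> makes the exponential of the
  initial budget \<open>W = d\<^sup>2\<close> equal to \<open>exp (1 / (1 - \<tau>))\<close>.
\<close>

lemma stable_index_averaged:
  fixes m :: nat
  assumes \<tau>2: "1/2 \<le> \<tau>" and e: "0 < e" "6 * e \<le> d" and \<eta>: "\<eta> \<le> (1 - \<tau>) * e\<^sup>2 / 16"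
    and m: "(1 - (1 - \<tau>) / 4) ^ m \<le> e\<^sup>2 / (5 * d\<^sup>2)"
    and L: "(192 * (d\<^sup>2 / e\<^sup>2)) ^ m * exp (1 / (1 - \<tau>)) \<le> real L"
  shows "\<exists>j < L. \<exists>Q. \<forall>I w t x. approx_solution ((1 - \<tau>) / 4) \<eta> G (K j) (K (Suc j)) I w t x
    \<longrightarrow> norm (x - Q) \<le> 2 * e"
proof -
  define \<delta> y S where "\<delta> = sqrt ((1 - \<tau>) * e\<^sup>2 / 16)" and "y = 1 - (1 - \<tau>) / 4" and "S = (\<Sum>i<m. y ^ i)"
  have \<delta>2: "\<delta>\<^sup>2 = (1 - \<tau>) * e\<^sup>2 / 16" and \<delta>: "0 < \<delta>" using \<tau> e by (auto simp: \<delta>_def)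
  have d: "0 < d" using e by linarith
  have D: "36 \<le> d\<^sup>2 / e\<^sup>2"
    using power_mono[OF e(2), of 2] e by (simp add: field_simps)
  obtain v where v: "v \<in> K L" using K(3) by blast
  have vz: "sqdist (K L) v = 0"
    using nearest_Pythagoras[OF K(1-3) v, of v] zero_le_power2[of "norm (nearest (K L) v - v)"]
      zero_le_power2[of "norm (v - nearest (K L) v)"]
    unfolding diff_self norm_zero power_zero_numeral by linarith
  have vC: "v \<in> C" using v K(4) by blast
  have ex: "12 * d\<^sup>2 / (192 * (d\<^sup>2 / e\<^sup>2) * \<delta>\<^sup>2) = 1 / (1 - \<tau>)"
    unfolding \<delta>2 using e d \<tau> by (simp add: field_simps)
  have pre: "sqdist (K L) v - sqdist (K 0) v \<le> \<delta>\<^sup>2"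
    unfolding vz using zero_le_power2[of \<delta>] zero_le_power2[of "norm (v - nearest (K 0) v)"] by linarith
  have "\<exists>j Q. 0 \<le> j \<and> j < L \<and> (\<forall>I w t x. approx_solution ((1 - \<tau>) / 4) \<eta> G (K j) (K (Suc j)) I w t x
      \<longrightarrow> (1 - \<tau>) / 32 * (\<Sum>i<m. (1 - (1 - \<tau>) / 4) ^ i) * (norm (x - Q))\<^sup>2
        \<le> (1 - (1 - \<tau>) / 4) ^ m * (\<Sum>n\<in>I. w n * (norm (v - G (t n)))\<^sup>2)
          + \<delta>\<^sup>2 * (\<Sum>i<m. (1 - (1 - \<tau>) / 4) ^ i))"
    by (rule averaged_search[where X = "192 * (d\<^sup>2 / e\<^sup>2)" and W = "d\<^sup>2", OF \<tau>2 _ \<delta> _ vC pre])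
      (use \<eta> \<delta>2 D L ex average_le_sq_diam_image[OF _ K(4) vC] in auto)
  then obtain j Q where j: "j < L" and Q: "\<And>I w t x. approx_solution ((1 - \<tau>) / 4) \<eta> G (K j) (K (Suc j)) I w t x
      \<Longrightarrow> (1 - \<tau>) / 32 * S * (norm (x - Q))\<^sup>2
        \<le> y ^ m * (\<Sum>n\<in>I. w n * (norm (v - G (t n)))\<^sup>2) + \<delta>\<^sup>2 * S"
    unfolding y_def S_def by blast
  have y: "0 < y" "y < 1" using \<tau> by (auto simp: y_def)
  have S: "(1 - \<tau>) / 4 * S = 1 - y ^ m"
    using y geometric_sum[of y m] \<tau> unfolding S_def by (simp add: y_def field_simps)
  have ym: "y ^ m \<le> 1 / 180" "y ^ m * d\<^sup>2 \<le> e\<^sup>2 / 5"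
  proof -
    have "e\<^sup>2 / (5 * d\<^sup>2) = 1 / (5 * (d\<^sup>2 / e\<^sup>2))" using e by simp
    also have "\<dots> \<le> 1 / 180" using D by (intro divide_left_mono) auto
    finally show "y ^ m \<le> 1 / 180" using m by (simp add: y_def)
    have "y ^ m * d\<^sup>2 \<le> e\<^sup>2 / (5 * d\<^sup>2) * d\<^sup>2" using m by (intro mult_right_mono) (auto simp: y_def)
    then show "y ^ m * d\<^sup>2 \<le> e\<^sup>2 / 5" using d by simp
  qed
  have "norm (x - Q) \<le> 2 * e"
    if sol: "approx_solution ((1 - \<tau>) / 4) \<eta> G (K j) (K (Suc j)) I w t x" for I w t x
  proof -
    have "y ^ m * (\<Sum>n\<in>I. w n * (norm (v - G (t n)))\<^sup>2) \<le> y ^ m * d\<^sup>2"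
      using y by (intro mult_left_mono average_le_sq_diam_image[OF sol K(4) vC]) auto
    then have "(1 - \<tau>) / 32 * S * (norm (x - Q))\<^sup>2 \<le> e\<^sup>2 / 5 + \<delta>\<^sup>2 * S" using Q[OF sol] ym(2) by linarith
    also have "\<delta>\<^sup>2 * S = e\<^sup>2 / 4 * ((1 - \<tau>) / 4 * S)" by (simp add: \<delta>2)
    also have "(1 - \<tau>) / 32 * S = ((1 - \<tau>) / 4 * S) / 8" by simp
    finally have "(1 - y ^ m) / 8 * (norm (x - Q))\<^sup>2 \<le> e\<^sup>2 / 5 + e\<^sup>2 / 4 * (1 - y ^ m)" unfolding S .
    also have "e\<^sup>2 / 5 = 8/5 * e\<^sup>2 / 8 * 1" by simp
    also have "8/5 * e\<^sup>2 / 8 * 1 \<le> 8/5 * e\<^sup>2 / 8 * ((1 - y ^ m) * (180/179))"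
      using ym(1) by (intro mult_left_mono) auto
    also have "8/5 * e\<^sup>2 / 8 * (z * (180/179)) + e\<^sup>2 / 4 * z = z / 8 * (8/5 * (180/179) * e\<^sup>2 + 2 * e\<^sup>2)"
      for z :: real by (simp add: field_simps)
    finally have "(1 - y ^ m) / 8 * (norm (x - Q))\<^sup>2 \<le> (1 - y ^ m) / 8 * (8/5 * (180/179) * e\<^sup>2 + 2 * e\<^sup>2)"
      by simp
    moreover have "0 < (1 - y ^ m) / 8" using ym(1) by simp
    ultimately have "(norm (x - Q))\<^sup>2 \<le> 8/5 * (180/179) * e\<^sup>2 + 2 * e\<^sup>2"
      by (simp only: mult_le_cancel_left_pos)
    also have "\<dots> \<le> (2 * e)\<^sup>2" by (simp add: power_mult_distrib)
    finally show ?thesis using e by (intro power2_le_imp_le[of "norm (x - Q)"]) auto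
  qed
  then show ?thesis using j by blast
qed

end


section \<open>The length of the search and the constants of the bound\<close>

text \<open>
  The powers of \<open>1 - \<tau>\<close> cancel in \<^const>\<open>eps_tilde\<close>, so \<^const>\<open>n_eps\<close> does not grow as \<open>\<tau>\<close> tends to 1.
\<close>

lemma eps_tilde_eq:
  assumes "\<tau> < 1"
  shows "eps_tilde \<tau> e d = e ^ 4 / (128 * (real d)\<^sup>2 * (6 + 8 * real d))"
proof -
  have "c / a * ((e / 2) ^ 4 / (8 * c * b)) = e ^ 4 / (128 * b * a)" if "c \<noteq> 0" for a b c :: real
    using that by (simp add: power_divide)
  from this[of "(1 - \<tau>)\<^sup>2" "6 + 8 * real d" "(real d)\<^sup>2"] show ?thesis
    using assms by (simp add: eps_tilde_def eps_d_def)
qed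

lemma eps_tilde_bounds:
  assumes "\<tau> < 1" "0 < d" "0 < e"
  shows "0 < eps_tilde \<tau> e d" "eps_tilde \<tau> e d \<le> e ^ 4 / (1792 * (real d)\<^sup>2)"
proof -
  show "0 < eps_tilde \<tau> e d" using assms by (simp add: eps_tilde_eq add_pos_pos)
  have "14 \<le> 6 + 8 * real d" using assms by simp
  then have "1792 * (real d)\<^sup>2 \<le> 128 * (real d)\<^sup>2 * (6 + 8 * real d)"
    using mult_left_mono[of 14 "6 + 8 * real d" "128 * (real d)\<^sup>2"] by simp
  then show "eps_tilde \<tau> e d \<le> e ^ 4 / (1792 * (real d)\<^sup>2)"
    unfolding eps_tilde_eq[OF assms(1)] using assms by (intro divide_left_mono) (auto intro!: mult_pos_pos add_pos_pos)
qed

lemma n_eps_large: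
  assumes "\<tau> < 1" "0 < d" "0 < e" "e \<le> 1"
  shows "57 * (192 * ((real d)\<^sup>2 / e\<^sup>2)) ^ 4 \<le> real (n_eps \<tau> e d)"
proof -
  define D where "D = real d"
  have D: "1 \<le> D" using assms by (simp add: D_def)
  note et = eps_tilde_bounds[OF assms(1-3), folded D_def]
  have "57 * (192 * (D\<^sup>2 / e\<^sup>2)) ^ 4 = 57 * 192 ^ 4 * (D ^ 8 * e ^ 8) / e ^ 16"
    using assms(3) by (simp add: field_simps flip: power_mult power_add)
  also have "\<dots> \<le> 8 * 1792 ^ 4 * D ^ 12 / e ^ 16"
  proof -
    have "D ^ 8 * e ^ 8 \<le> D ^ 12 * 1"
      using D assms(3,4) by (intro mult_mono power_increasing power_le_one) auto
    then have "57 * 192 ^ 4 * (D ^ 8 * e ^ 8) \<le> 57 * 192 ^ 4 * (D ^ 12 * 1)"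
      by (intro mult_left_mono) auto
    also have "\<dots> \<le> 8 * 1792 ^ 4 * D ^ 12" using D by simp
    finally have "57 * 192 ^ 4 * (D ^ 8 * e ^ 8) \<le> 8 * 1792 ^ 4 * D ^ 12" .
    then show ?thesis using assms(3) by (intro divide_right_mono) auto
  qed
  also have "\<dots> = 8 * D ^ 4 / (e ^ 4 / (1792 * D\<^sup>2)) ^ 4"
    using assms(3) D by (simp add: power_divide power_mult_distrib field_simps flip: power_mult power_add)
  also have "\<dots> \<le> 8 * D ^ 4 / eps_tilde \<tau> e d ^ 4"
    using et assms(3) D by (intro divide_left_mono power_mono) auto
  also have "\<dots> \<le> real (n_eps \<tau> e d)" unfolding n_eps_def D_def by linarith
  finally show ?thesis by (simp add: D_def)
qed

lemma power_i_zero_le: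
  assumes "0 \<le> \<tau>" "\<tau> < 1" "0 < d" "0 < e"
  shows "\<tau> ^ Suc (i_zero \<tau> e d) \<le> eps_tilde \<tau> e d / (6 * (real d)\<^sup>2)"
proof (cases "\<tau> = 0")
  case True
  then show ?thesis using eps_tilde_bounds(1)[OF assms(2-4)] by (simp add: less_imp_le)
next
  case False
  define Y where "Y = eps_tilde \<tau> e d / (6 * (real d)\<^sup>2)"
  have Y: "0 < Y" using eps_tilde_bounds(1)[OF assms(2-4)] assms(3) by (simp add: Y_def)
  have \<tau>: "0 < \<tau>" "\<tau> < 1" using False assms by auto
  have "log \<tau> Y \<le> real (Suc (i_zero \<tau> e d))"
    unfolding i_zero_def Y_def[symmetric] by linarith
  then have "\<tau> powr real (Suc (i_zero \<tau> e d)) \<le> \<tau> powr log \<tau> Y"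
    using \<tau> by (intro powr_mono') auto
  then show ?thesis using \<tau> Y by (simp add: powr_realpow Y_def[symmetric] del: power_Suc of_nat_Suc)
qed

lemma i_zero_lower:
  assumes "1/2 \<le> \<tau>" "\<tau> < 1" "0 < d" "0 < e"
  shows "ln (100 * ((real d)\<^sup>2 / e\<^sup>2)) / (1 - \<tau>) - 1 \<le> real (i_zero \<tau> e d)"
proof -
  define Y D where "Y = eps_tilde \<tau> e d / (6 * (real d)\<^sup>2)" and "D = (real d)\<^sup>2 / e\<^sup>2"
  have D: "0 < D" using assms by (simp add: D_def)
  have Y: "0 < Y" using eps_tilde_bounds(1)[OF assms(2-4)] assms(3) by (simp add: Y_def)
  have "Y \<le> e ^ 4 / (1792 * (real d)\<^sup>2) / (6 * (real d)\<^sup>2)"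
    unfolding Y_def by (intro divide_right_mono eps_tilde_bounds(2)[OF assms(2-4)]) simp
  also have "\<dots> = 1 / (10752 * D\<^sup>2)"
    using assms by (simp add: D_def field_simps flip: power_mult power_add)
  also have "\<dots> \<le> 1 / (100 * D)\<^sup>2" using D by (intro divide_left_mono) (auto simp: power_mult_distrib)
  finally have "ln Y \<le> ln (1 / (100 * D)\<^sup>2)" using Y D by (subst ln_le_cancel_iff) auto
  also have "\<dots> = - ln ((100 * D)\<^sup>2)" using D by (subst ln_div) auto
  also have "ln ((100 * D)\<^sup>2) = 2 * ln (100 * D)" using D by (subst ln_realpow) auto
  finally have lnY: "2 * ln (100 * D) \<le> - ln Y" by simp
  have "ln (1 / \<tau>) \<le> 1 / \<tau> - 1" using assms by (intro ln_le_minus_one) auto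
  also have "\<dots> = (1 - \<tau>) / \<tau>" using assms by (simp add: field_simps)
  also have "\<dots> \<le> (1 - \<tau>) / (1/2)" using assms by (intro divide_left_mono) auto
  finally have ln\<tau>: "- ln \<tau> \<le> 2 * (1 - \<tau>)" using assms by (simp add: ln_div)
  have ln\<tau>0: "0 < - ln \<tau>" using assms by simp
  show ?thesis
  proof (cases "0 \<le> ln (100 * D)")
    case True
    have "ln (100 * D) / (1 - \<tau>) = 2 * ln (100 * D) / (2 * (1 - \<tau>))"
      by (rule mult_divide_mult_cancel_left[symmetric]) simp
    also have "\<dots> \<le> (- ln Y) / (- ln \<tau>)" using lnY ln\<tau> ln\<tau>0 True by (intro frac_le) auto
    also have "\<dots> = log \<tau> Y" by (simp add: log_def)
    also have "\<dots> \<le> real (i_zero \<tau> e d) + 1" unfolding i_zero_def Y_def by linarith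
    finally show ?thesis by (simp add: D_def)
  next
    case False
    then have "ln (100 * D) / (1 - \<tau>) \<le> 0" using assms by (simp add: divide_nonpos_pos)
    then show ?thesis unfolding D_def by linarith
  qed
qed


context nested_convex_sets
begin

text \<open>
  The length \<open>L\<close> of the search is multiplied by 8 because each set of the sequence will use up eight iterations
  of the counterfunction, and \<open>3 * i\<close> further iterations will make \<open>k\<close> large enough to begin with. The count rests on
  \<open>57 X ^ 4 \<le> n_eps\<close>. For \<open>\<tau> > 1/2\<close> the number \<open>m\<close> of averaged steps is at most
  \<open>4 * i_zero\<close>, and \<open>1 / (1 - \<tau>) \<le> i_zero\<close>, so that \<open>L \<le> (3 X ^ 4) ^ i_zero + 1\<close>.
\<close>

lemma stable_index_exists:
  fixes dn :: nat
  assumes d: "d = real dn" "0 < dn" and e: "0 < e" "6 * e \<le> 1"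
    and \<eta>: "\<eta> \<le> (1 - \<tau>) * e\<^sup>2 / 16" and i: "i = max 1 (i_zero \<tau> e dn)"
  shows "\<exists>L. 3 * i + 8 * L \<le> n_eps \<tau> e dn ^ i \<and>
    (\<exists>j < L. \<exists>Q. \<forall>I w t x. approx_solution ((1 - \<tau>) / 4) \<eta> G (K j) (K (Suc j)) I w t x
      \<longrightarrow> norm (x - Q) \<le> 2 * e)"
proof -
  define D X i0 N where "D = d\<^sup>2 / e\<^sup>2" and "X = 192 * D" and "i0 = i_zero \<tau> e dn" and "N = n_eps \<tau> e dn"
  have d1: "1 \<le> d" using d by simp
  have ed: "6 * e \<le> d" using e d1 by linarith
  have D: "36 \<le> D"
    using power_mono[OF ed, of 2] e by (simp add: D_def field_simps)
  have XN: "57 * X ^ 4 \<le> real N"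
    using n_eps_large[OF \<tau>(2) d(2) e(1)] e unfolding X_def D_def N_def d(1) by simp
  have i1: "1 \<le> i" using i by simp
  have i_le: "real i \<le> y" if "y = z ^ i" "2 \<le> z" for y z :: real
    using that power_mono[of 2 z i] of_nat_less_two_power[where 'a=real and n=i] by linarith
  show ?thesis
  proof (cases "\<tau> \<le> 1/2")
    case True
    define n where "n = nat \<lceil>32 * D\<rceil>"
    have n: "32 * D \<le> real n" "real n \<le> X" "2 \<le> real n" using D by (auto simp: n_def X_def) linarith+
    have n0: "0 < n" using n by (cases n) auto
    have "11 * (real n)\<^sup>2 \<le> real N"
    proof -
      have "(real n)\<^sup>2 \<le> X\<^sup>2" using n by (intro power_mono) auto
      also have "\<dots> \<le> X ^ 4" using D by (intro power_increasing) (auto simp: X_def)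
      finally show ?thesis using XN zero_le_power2[of "real n"] by linarith
    qed
    then have "(11 * (real n)\<^sup>2) ^ i \<le> real N ^ i" by (intro power_mono) auto
    moreover have "11 * real n ^ (i0 + 1) \<le> (11 * (real n)\<^sup>2) ^ i"
    proof -
      have "11 ^ 1 * real n ^ (i0 + 1) \<le> 11 ^ i * real n ^ (2 * i)"
        using i n by (intro mult_mono power_increasing) (auto simp: i0_def)
      then show ?thesis by (simp add: power_mult_distrib power_mult)
    qed
    moreover have "real i \<le> real n ^ (i0 + 1)"
    proof -
      have "i \<le> i0 + 1" using i by (simp add: i0_def)
      then have "real n ^ i \<le> real n ^ (i0 + 1)" using n by (intro power_increasing) auto
      then show ?thesis using i_le[OF refl n(3)] by linarith
    qed
    ultimately have "3 * real i + 8 * real n ^ (i0 + 1) \<le> real N ^ i" by linarith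
    then have "real (3 * i + 8 * n ^ (i0 + 1)) \<le> real (N ^ i)" by simp
    then have "3 * i + 8 * n ^ (i0 + 1) \<le> N ^ i" by (simp only: of_nat_le_iff)
    moreover have "\<tau> ^ Suc i0 * d\<^sup>2 \<le> (1 - \<tau>) * e\<^sup>2 / 16"
    proof -
      have "\<tau> ^ Suc i0 * d\<^sup>2 \<le> eps_tilde \<tau> e dn / (6 * d\<^sup>2) * d\<^sup>2"
        using power_i_zero_le[OF \<tau> d(2) e(1)] unfolding i0_def d(1) by (intro mult_right_mono) auto
      also have "\<dots> = eps_tilde \<tau> e dn / 6" using d1 by simp
      also have "\<dots> \<le> e ^ 4 / (1792 * d\<^sup>2) / 6"
        using eps_tilde_bounds(2)[OF \<tau>(2) d(2) e(1)] unfolding d(1) by simp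
      also have "\<dots> \<le> e ^ 4 / 1792 / 6"
        using d1 by (intro divide_right_mono divide_left_mono) (auto simp: one_le_power)
      also have "\<dots> \<le> e\<^sup>2 * 1 / 1792 / 6"
      proof -
        have "e\<^sup>2 * e\<^sup>2 \<le> e\<^sup>2 * 1" using e by (intro mult_left_mono power_le_one) auto
        then show ?thesis by (simp flip: power_add)
      qed
      also have "\<dots> \<le> 1/2 * e\<^sup>2 / 16" by simp
      also have "\<dots> \<le> (1 - \<tau>) * e\<^sup>2 / 16" using True by (intro divide_right_mono mult_right_mono) auto
      finally show ?thesis .
    qed
    ultimately show ?thesis
      using stable_index_Picard[OF True e(1) \<eta> n0 n(1)[unfolded D_def], of i0]
      by (intro exI[of _ "n ^ (i0 + 1)"]) (auto simp: N_def)
  next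
    case False
    define \<rho> m where "\<rho> = 1 - \<tau>" and "m = nat \<lceil>4 * ln (5 * D) / \<rho>\<rceil>"
    have \<rho>: "0 < \<rho>" "\<rho> \<le> 1/2" using False \<tau> by (auto simp: \<rho>_def)
    have r2: "2 \<le> 1 / \<rho>" using \<rho> by (simp add: field_simps)
    have ln5: "0 \<le> ln (5 * D)" using D by simp
    have i0: "ln (100 * D) / \<rho> - 1 \<le> real i0"
      using i_zero_lower[OF _ \<tau>(2) d(2) e(1)] False unfolding \<rho>_def D_def d(1) i0_def by simp
    have e3: "exp 1 \<le> (3::real)" by (rule exp_le)
    have ln20: "1 \<le> ln (20::real)" using e3 by (simp add: ln_ge_iff)
    have ln100: "2 \<le> ln (100 * D)"
    proof -
      have "exp 2 = exp 1 * exp (1::real)" by (simp flip: exp_add)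
      also have "\<dots> \<le> 3 * 3" using e3 by (intro mult_mono) auto
      finally show ?thesis using D by (simp add: ln_ge_iff)
    qed
    have "2 * (1 / \<rho>) \<le> ln (100 * D) * (1 / \<rho>)" using ln100 \<rho> by (intro mult_right_mono) auto
    then have i0r: "1 / \<rho> \<le> real i0" using i0 r2 by simp
    then have ii: "i = i0" using i r2 by (simp add: i0_def)
    have m_ge: "4 * ln (5 * D) / \<rho> \<le> real m" unfolding m_def by linarith
    have "real m \<le> 4 * ln (5 * D) / \<rho> + 1"
    proof -
      have "0 \<le> 4 * ln (5 * D) / \<rho>" using ln5 \<rho> by simp
      then show ?thesis unfolding m_def by linarith
    qed
    also have "\<dots> \<le> 4 * real i0"
    proof -
      have "ln (100 * D) = ln 20 + ln (5 * D)" using D ln_mult_pos[of 20 "5 * D"] by simp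
      then have "(1 + ln (5 * D)) * (1 / \<rho>) \<le> ln (100 * D) * (1 / \<rho>)"
        using ln20 \<rho> by (intro mult_right_mono) auto
      then have "1 / \<rho> + ln (5 * D) / \<rho> \<le> ln (100 * D) / \<rho>" by (simp add: add_divide_distrib)
      then show ?thesis using i0 r2 by simp
    qed
    finally have m_le: "m \<le> 4 * i0" by linarith
    define y L where "y = (3 * X ^ 4) ^ i0" and "L = nat \<lceil>X ^ m * exp (1 / \<rho>)\<rceil>"
    have X: "2 \<le> X" using D by (simp add: X_def)
    have X4: "16 \<le> X ^ 4" using power_mono[OF X, of 4] by simp
    have "X ^ m * exp (1 / \<rho>) \<le> X ^ (4 * i0) * 3 ^ i0"
    proof (rule mult_mono)
      show "X ^ m \<le> X ^ (4 * i0)" using m_le X by (intro power_increasing) auto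
      have "exp (1 / \<rho>) \<le> exp (real i0)" using i0r by simp
      also have "\<dots> = exp 1 ^ i0" by (simp flip: exp_of_nat_mult)
      also have "\<dots> \<le> 3 ^ i0" by (intro power_mono e3) auto
      finally show "exp (1 / \<rho>) \<le> 3 ^ i0" .
    qed (use X in auto)
    also have "\<dots> = y" by (simp add: y_def power_mult power_mult_distrib)
    finally have Ly: "X ^ m * exp (1 / \<rho>) \<le> y" .
    have y1: "1 \<le> y" using X4 unfolding y_def by (intro one_le_power) auto
    have "0 \<le> X ^ m * exp (1 / \<rho>)" using X by simp
    then have "real L \<le> y + 1" using Ly unfolding L_def by linarith
    moreover have "real i \<le> y" using i_le[of y "3 * X ^ 4"] X4 ii by (simp add: y_def)
    moreover have "19 * y \<le> real N ^ i"
    proof -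
      have "19 ^ 1 * (3 * X ^ 4) ^ i \<le> 19 ^ i * (3 * X ^ 4) ^ i"
        using i1 X4 by (intro mult_right_mono power_increasing) auto
      also have "\<dots> = (57 * X ^ 4) ^ i" by (subst power_mult_distrib[symmetric]) (simp add: mult.assoc)
      also have "\<dots> \<le> real N ^ i" using XN X4 by (intro power_mono) auto
      finally show ?thesis by (simp add: y_def ii)
    qed
    ultimately have "3 * real i + 8 * real L \<le> real N ^ i" using y1 by linarith
    then have "real (3 * i + 8 * L) \<le> real (N ^ i)" by simp
    then have "3 * i + 8 * L \<le> N ^ i" by (simp only: of_nat_le_iff)
    moreover have "(1 - (1 - \<tau>) / 4) ^ m \<le> e\<^sup>2 / (5 * d\<^sup>2)"
    proof -
      have "(1 - (1 - \<tau>) / 4) ^ m \<le> exp (- (\<rho> / 4)) ^ m"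
        using exp_ge_add_one_self[of "- (\<rho> / 4)"] \<tau> by (intro power_mono) (auto simp: \<rho>_def)
      also have "\<dots> = exp (- (\<rho> / 4 * real m))" by (simp add: mult.commute flip: exp_of_nat_mult)
      also have "\<dots> \<le> exp (- ln (5 * D))"
      proof -
        have "4 * ln (5 * D) / \<rho> * \<rho> \<le> real m * \<rho>" using m_ge \<rho> by (intro mult_right_mono) auto
        then show ?thesis using \<rho> by (simp add: algebra_simps)
      qed
      also have "\<dots> = 1 / (5 * D)" using D by (simp add: exp_minus inverse_eq_divide)
      also have "\<dots> = e\<^sup>2 / (5 * d\<^sup>2)" using e by (simp add: D_def)
      finally show ?thesis .
    qed
    moreover have "X ^ m * exp (1 / \<rho>) \<le> real L" unfolding L_def by linarith
    ultimately show ?thesis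
      using stable_index_averaged[OF _ e(1) ed \<eta>, of m L] False
      by (intro exI[of _ L]) (auto simp: N_def X_def D_def \<rho>_def)
  qed
qed

end

lemma two_power_i_zero:
  assumes "0 \<le> \<tau>" "\<tau> < 1" "0 < d" "0 < e" "6 * e \<le> 1"
  shows "1 / (1 - \<tau>) \<le> 2 ^ max 1 (i_zero \<tau> e d)"
proof (cases "\<tau> \<le> 1/2")
  case True
  then have "1 / (1 - \<tau>) \<le> 2 ^ 1" using assms by (simp add: field_simps)
  also have "\<dots> \<le> 2 ^ max 1 (i_zero \<tau> e d)" by (intro power_increasing) auto
  finally show ?thesis .
next
  case False
  define D where "D = (real d)\<^sup>2 / e\<^sup>2"
  have "36 \<le> D"
    using power_mono[of "6 * e" "real d" 2] assms by (simp add: D_def field_simps)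
  have "exp 2 = exp 1 * exp (1::real)" by (simp flip: exp_add)
  also have "\<dots> \<le> 3 * 3" using exp_le by (intro mult_mono) auto
  finally have "2 \<le> ln (100 * D)" using \<open>36 \<le> D\<close> by (simp add: ln_ge_iff)
  then have "2 * (1 / (1 - \<tau>)) \<le> ln (100 * D) * (1 / (1 - \<tau>))" using assms by (intro mult_right_mono) auto
  moreover have "1 \<le> 1 / (1 - \<tau>)" using assms by (simp add: field_simps)
  ultimately have "1 / (1 - \<tau>) \<le> real (i_zero \<tau> e d)"
    using i_zero_lower[OF _ assms(2-4)] False unfolding D_def by simp
  also have "\<dots> \<le> 2 ^ i_zero \<tau> e d"
    using of_nat_less_two_power[where 'a=real and n="i_zero \<tau> e d"] by simp
  also have "\<dots> \<le> 2 ^ max 1 (i_zero \<tau> e d)" by (intro power_increasing) auto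
  finally show ?thesis .
qed

section \<open>Hulls of almost fixed points\<close>

text \<open>
  The almost fixed points of a nonexpansive map do not form a convex set; their closed convex hull replaces them.
\<close>

definition almost_fixed_hull :: "'a::real_inner set \<Rightarrow> ('a \<Rightarrow> 'a) \<Rightarrow> real \<Rightarrow> 'a set"
  where "almost_fixed_hull C T r = closure (convex hull {z \<in> C. norm (z - T z) \<le> r})"

lemma almost_fixed_hull_props:
  shows closed_almost_fixed_hull: "closed (almost_fixed_hull C T r)"
    and convex_almost_fixed_hull: "convex (almost_fixed_hull C T r)"
    and almost_fixed_hull_mono: "r \<le> s \<Longrightarrow> almost_fixed_hull C T r \<subseteq> almost_fixed_hull C T s"
    and almost_fixed_hull_memI: "z \<in> C \<Longrightarrow> norm (z - T z) \<le> r \<Longrightarrow> z \<in> almost_fixed_hull C T r"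
    and almost_fixed_hull_subset: "closed C \<Longrightarrow> convex C \<Longrightarrow> almost_fixed_hull C T r \<subseteq> C"
proof -
  show "closed (almost_fixed_hull C T r)" "convex (almost_fixed_hull C T r)"
    by (auto simp: almost_fixed_hull_def convex_closure)
  show "r \<le> s \<Longrightarrow> almost_fixed_hull C T r \<subseteq> almost_fixed_hull C T s"
    unfolding almost_fixed_hull_def by (intro closure_mono hull_mono) auto
  show "z \<in> C \<Longrightarrow> norm (z - T z) \<le> r \<Longrightarrow> z \<in> almost_fixed_hull C T r"
    unfolding almost_fixed_hull_def by (intro subsetD[OF closure_subset] hull_inc) auto
  show "closed C \<Longrightarrow> convex C \<Longrightarrow> almost_fixed_hull C T r \<subseteq> C"
    unfolding almost_fixed_hull_def by (intro closure_minimal hull_minimal) auto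
qed

text \<open>
  For fixed \<open>z\<close> the difference of the squared distances from \<open>y\<close> to \<open>T z\<close> and to \<open>z\<close> is affine in \<open>y\<close>. A bound
  on it for all almost fixed points \<open>y\<close> thus extends to their closed convex hull, and in particular to \<open>y = z\<close>.
\<close>

lemma almost_fixed_hull_displacement:
  assumes C: "closed C" "convex C" and T: "\<And>x y. x \<in> C \<Longrightarrow> y \<in> C \<Longrightarrow> norm (T x - T y) \<le> norm (x - y)"
    and d: "\<And>x y. x \<in> C \<Longrightarrow> y \<in> C \<Longrightarrow> norm (x - y) \<le> d" and r: "0 \<le> r"
    and z: "z \<in> almost_fixed_hull C T r"
  shows "(norm (z - T z))\<^sup>2 \<le> 2 * d * r + r\<^sup>2"
proof -
  have zC: "z \<in> C" using z almost_fixed_hull_subset[OF C] by blast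
  define b where "b = 2 * d * r + r\<^sup>2 - (norm (T z))\<^sup>2 + (norm z)\<^sup>2"
  have eq: "(norm (y - T z))\<^sup>2 - (norm (y - z))\<^sup>2 \<le> 2 * d * r + r\<^sup>2 \<longleftrightarrow> (2 *\<^sub>R (z - T z)) \<bullet> y \<le> b" for y
    unfolding b_def power2_norm_eq_inner by (simp add: inner_simps inner_commute algebra_simps)
  have "{y \<in> C. norm (y - T y) \<le> r} \<subseteq> {y. (2 *\<^sub>R (z - T z)) \<bullet> y \<le> b}"
  proof
    fix y assume "y \<in> {y \<in> C. norm (y - T y) \<le> r}"
    then have y: "y \<in> C" "norm (y - T y) \<le> r" by auto
    have "norm (y - T z) \<le> norm (y - T y) + norm (T y - T z)" 
      using norm_triangle_ineq[of "y - T y" "T y - T z"] by simp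
    also have "\<dots> \<le> r + norm (y - z)" by (intro add_mono y T zC)
    finally have "(norm (y - T z))\<^sup>2 \<le> (r + norm (y - z))\<^sup>2" by (intro power_mono) auto
    also have "\<dots> = r\<^sup>2 + 2 * norm (y - z) * r + (norm (y - z))\<^sup>2" by (simp add: power2_sum)
    also have "2 * norm (y - z) * r \<le> 2 * d * r" using d[OF y(1) zC] r by (intro mult_right_mono) auto
    finally have "(norm (y - T z))\<^sup>2 - (norm (y - z))\<^sup>2 \<le> 2 * d * r + r\<^sup>2" by linarith
    then show "y \<in> {y. (2 *\<^sub>R (z - T z)) \<bullet> y \<le> b}" unfolding eq by blast
  qed
  then have "almost_fixed_hull C T r \<subseteq> {y. (2 *\<^sub>R (z - T z)) \<bullet> y \<le> b}"
    unfolding almost_fixed_hull_def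
    by (intro closure_minimal hull_minimal closed_halfspace_le convex_halfspace_le)
  then have "(2 *\<^sub>R (z - T z)) \<bullet> z \<le> b" using z by blast
  then show ?thesis using eq[of z] by simp
qed

text \<open>
  The squared displacement on the hull is of the order of \<open>d / k\<close>; this is why \<^const>\<open>tilde\<close> contains the
  term \<open>16 * d * n\<^sup>2\<close>.
\<close>

lemma almost_fixed_hull_displacement_reciprocal:
  fixes d k y :: nat
  assumes C: "closed C" "convex C" and T: "\<And>x y. x \<in> C \<Longrightarrow> y \<in> C \<Longrightarrow> norm (T x - T y) \<le> norm (x - y)"
    and diam: "\<And>x y. x \<in> C \<Longrightarrow> y \<in> C \<Longrightarrow> norm (x - y) \<le> real d"
    and d: "0 < d" and y: "0 < y" and k: "16 * d * y\<^sup>2 \<le> k"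
    and z: "z \<in> almost_fixed_hull C T (1 / real k)"
  shows "norm (z - T z) \<le> 1 / real y"
proof -
  define r where "r = 1 / real k"
  have d1: "1 \<le> real d" using d by simp
  have "0 < 16 * d * y\<^sup>2" using d y by simp
  then have k0: "0 < k" using k by linarith
  have k': "real (16 * d * y\<^sup>2) \<le> real k" using k by (simp only: of_nat_le_iff)
  have "r \<le> 1 / real (16 * d * y\<^sup>2)"
    unfolding r_def using k' k0 d y by (intro divide_left_mono) auto
  also have "\<dots> = 1 / (16 * real d * (real y)\<^sup>2)" by simp
  finally have "16 * real d * r \<le> 16 * real d * (1 / (16 * real d * (real y)\<^sup>2))"
    by (intro mult_left_mono) auto
  then have r: "16 * real d * r \<le> 1 / (real y)\<^sup>2" using d by simp
  have r0: "0 \<le> r" "r \<le> 1" using k0 by (auto simp: r_def)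
  have "(norm (z - T z))\<^sup>2 \<le> 2 * real d * r + r\<^sup>2"
    by (rule almost_fixed_hull_displacement[where C = C])
      (fact C T diam r0(1) z[folded r_def])+
  also have "r\<^sup>2 \<le> real d * r"
    unfolding power2_eq_square using r0 d1 by (intro mult_right_mono) auto
  also have "2 * real d * r + real d * r \<le> 16 * real d * r" using r0 by simp
  also have "\<dots> \<le> (1 / real y)\<^sup>2" using r by (simp add: power_divide)
  finally show ?thesis using power2_le_imp_le by fastforce
qed


section \<open>Growth of the counterfunctions\<close>

lemma max_upto_ge: "i \<le> n \<Longrightarrow> F i \<le> max_upto F n"
  by (simp add: max_upto_def)

lemma max_upto_mono: "m \<le> n \<Longrightarrow> max_upto F m \<le> max_upto F n"
  unfolding max_upto_def by (intro Max_mono) auto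

lemma tilde_ge:
  shows tilde_ge_square: "16 * d * n\<^sup>2 \<le> tilde d F n"
    and tilde_ge_fun: "m \<le> 16 * d * n\<^sup>2 \<Longrightarrow> F m \<le> tilde d F n"
  using max_upto_ge[of m "16 * d * n\<^sup>2" F] by (auto simp: tilde_def)

lemma tilde_mono: "m \<le> n \<Longrightarrow> tilde d F m \<le> tilde d F n"
  unfolding tilde_def by (intro max.mono max_upto_mono mult_le_mono2 power_mono) auto

lemma double_le_square: "2 * n \<le> 16 * d * n\<^sup>2" if "0 < d" for n d :: nat
proof (cases "n = 0")
  case False
  then have "0 < d * n" using that by simp
  then have "2 * n \<le> (16 * (d * n)) * n" by (intro mult_le_mono1) linarith
  then show ?thesis by (simp add: power2_eq_square)
qed simp

lemma le_square: "0 < d \<Longrightarrow> n \<le> 16 * d * n\<^sup>2" for n d :: nat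
  using double_le_square[of d n] by linarith

lemma tilde_expanding: "0 < d \<Longrightarrow> n \<le> tilde d F n"
  using le_square tilde_ge_square order_trans by blast

lemma funpow_tilde_mono:
  assumes "0 < d" "i \<le> j"
  shows "(tilde d F ^^ i) n \<le> (tilde d F ^^ j) n"
  using assms(2)
proof (induction rule: dec_induct)
  case (step k) then show ?case using tilde_expanding[OF assms(1), of "(tilde d F ^^ k) n" F] by simp
qed simp

lemma mono_funpow_arg: "m \<le> n \<Longrightarrow> (tilde d F ^^ i) m \<le> (tilde d F ^^ i) n"
  by (induction i) (auto intro: tilde_mono)

lemma funpow_le_funpow:
  fixes f g :: "nat \<Rightarrow> nat"
  assumes "\<And>n. f n \<le> g n" "\<And>m n. m \<le> n \<Longrightarrow> g m \<le> g n"
  shows "(f ^^ i) n \<le> (g ^^ i) n"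
proof (induction i)
  case (Suc i)
  then show ?case using assms(1)[of "(f ^^ i) n"] assms(2)[of "(f ^^ i) n" "(g ^^ i) n"] by simp
qed simp

lemma k_seq_Suc_ge:
  assumes "0 < d" "n \<le> k_seq d N (tilde d F) i"
  shows "(tilde d F ^^ (N ^ Suc i)) n \<le> k_seq d N (tilde d F) (Suc i)"
proof -
  let ?g = "f_level N (tilde d F) i"
  have "(tilde d F ^^ (N ^ Suc i)) n \<le> (tilde d F ^^ (N ^ Suc i)) (k_seq d N (tilde d F) i)"
    by (rule mono_funpow_arg) (rule assms)
  also have "\<dots> = (?g ^^ N) (k_seq d N (tilde d F) i)"
    by (simp add: f_level_def funpow_mult mult.commute)
  also have "\<dots> \<le> (tilde d ?g ^^ N) (k_seq d N (tilde d F) i)"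
    by (rule funpow_le_funpow) (auto intro: tilde_mono tilde_ge_fun le_square[OF assms(1)])
  finally show ?thesis by simp
qed

text \<open>
  Only the topmost of the levels that build up \<^const>\<open>k_seq\<close> is used. It contains \<open>N\<close> iterations of
  \<open>f_level N F (i - 1)\<close>, hence \<open>N ^ i\<close> iterations of \<open>F\<close>.
\<close>

lemma k_seq_ge:
  assumes "0 < d"
  shows "(tilde d F ^^ (N ^ max 1 i)) 1 \<le> k_seq d N (tilde d F) i"
proof (induction i)
  case 0
  have "(tilde d F ^^ N) 1 \<le> (tilde d (f_level N (tilde d F) 0) ^^ N) 1"
    by (rule funpow_le_funpow) (auto intro: tilde_mono tilde_ge_fun le_square[OF assms] simp: f_level_def)
  then show ?case by simp
next
  case (Suc i)
  have "1 \<le> (tilde d F ^^ (N ^ max 1 i)) 1"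
    using funpow_tilde_mono[OF assms, of 0 "N ^ max 1 i" F 1] by simp
  then have "1 \<le> k_seq d N (tilde d F) i" using Suc by linarith
  then show ?case using k_seq_Suc_ge[OF assms, of 1 N F i] by simp
qed

lemma funpow_tilde_ge_two_power:
  assumes "0 < d"
  shows "2 ^ i \<le> (tilde d F ^^ i) 1"
proof (induction i)
  case (Suc i)
  define k where "k = (tilde d F ^^ i) 1"
  have "2 * k \<le> tilde d F k" using double_le_square[OF assms] tilde_ge_square order_trans by blast
  then show ?case using Suc by (simp add: k_def)
qed simp


section \<open>The viscosity iteration\<close>

text \<open>
  The proofs below follow the points \<open>T (u n)\<close> rather than \<open>u n\<close>: the iteration step is a convex combination
  of \<open>T (u n)\<close> and its image under \<open>G\<close>.
\<close>

locale viscosity_iteration =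
  fixes C :: "'a::{real_inner, complete_space} set" and T G :: "'a \<Rightarrow> 'a"
    and \<tau> d :: real and lam :: "nat \<Rightarrow> real" and u :: "nat \<Rightarrow> 'a"
  assumes closed_C: "closed C" and convex_C: "convex C"
    and dist_le: "x \<in> C \<Longrightarrow> y \<in> C \<Longrightarrow> norm (x - y) \<le> d"
    and T_mem: "x \<in> C \<Longrightarrow> T x \<in> C"
    and T_nonexp: "x \<in> C \<Longrightarrow> y \<in> C \<Longrightarrow> norm (T x - T y) \<le> norm (x - y)"
    and G_mem: "x \<in> C \<Longrightarrow> G x \<in> C"
    and G_lipschitz: "x \<in> C \<Longrightarrow> y \<in> C \<Longrightarrow> norm (G x - G y) \<le> \<tau> * norm (x - y)"
    and \<tau>: "0 \<le> \<tau>" "\<tau> < 1"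
    and lam: "0 < lam n" "lam n \<le> 1"
    and u0: "u 0 \<in> C"
    and u_Suc: "u (Suc n) = (1 - lam (Suc n)) *\<^sub>R T (u n) + lam (Suc n) *\<^sub>R G (T (u n))"
begin

lemma u_mem: "u n \<in> C"
proof (induction n)
  case (Suc n)
  then show ?case
    unfolding u_Suc using lam[of "Suc n"] by (intro convexD[OF convex_C] G_mem T_mem) auto
qed (rule u0)

lemma Tu_mem: "T (u n) \<in> C" by (rule T_mem[OF u_mem])

lemma d_nonneg: "0 \<le> d" using dist_le[OF u_mem u_mem, of 0 0] by simp

text \<open>
  The ratio of \<open>norm (u (n + 1) - u n)\<close> to \<open>lam (n + 1)\<close> does not increase above the value that it may have at
  \<open>n1\<close>: the contraction by \<open>1 - (1 - \<tau>) lam\<close> outweighs the growth of \<open>1 / lam\<close> and the perturbation caused by the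
  change of \<open>lam\<close>, both of which are governed by \<open>\<delta> \<le> (1 - \<tau>) / 6\<close>. Hence the increments tend to 0 together with \<open>lam\<close>.
\<close>

lemma increment_le:
  assumes \<delta>: "0 \<le> \<delta>" "\<delta> \<le> (1 - \<tau>) / 6"
    and slow: "\<And>n. n1 \<le> n \<Longrightarrow> \<bar>lam n - lam (Suc n)\<bar> \<le> \<delta> * (lam (Suc n))\<^sup>2"
    and B: "d \<le> B * lam (Suc n1)" and "n1 \<le> n"
  shows "norm (u (Suc n) - u n) \<le> B * lam (Suc n)"
  using \<open>n1 \<le> n\<close>
proof (induction rule: dec_induct)
  case base
  show ?case using dist_le[OF u_mem u_mem] B by (rule order_trans)
next
  case (step n)
  define l l' where "l = lam (Suc n)" and "l' = lam (Suc (Suc n))"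
  define x y where "x = T (u n)" and "y = T (u (Suc n))"
  have l: "0 < l" "0 < l'" "l' \<le> 1" using lam by (auto simp: l_def l'_def)
  have B0: "0 \<le> B"
    using B d_nonneg lam(1)[of "Suc n1"] by (metis mult_neg_pos not_le order_trans)
  have "B * lam (Suc n1) \<le> B * 1" using lam(2) B0 by (intro mult_left_mono)
  then have dB: "d \<le> B" using B by linarith
  have xy: "x \<in> C" "y \<in> C" by (auto simp: x_def y_def Tu_mem)
  have sl: "\<bar>l - l'\<bar> \<le> \<delta> * l'\<^sup>2" using slow[of "Suc n"] step by (simp add: l_def l'_def)
  have yx: "norm (y - x) \<le> B * l"
    using T_nonexp[OF u_mem u_mem, of "Suc n" n] step by (simp add: x_def y_def l_def)
  have Gyx: "norm (G y - G x) \<le> \<tau> * (B * l)"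
    using G_lipschitz[OF xy(2,1)] mult_left_mono[OF yx \<tau>(1)] by linarith
  have "u (Suc (Suc n)) - u (Suc n) = (1 - l') *\<^sub>R (y - x) + l' *\<^sub>R (G y - G x) + (l' - l) *\<^sub>R (G x - x)"
    unfolding u_Suc[of "Suc n"] u_Suc[of n] x_def y_def l_def l'_def by (simp add: algebra_simps)
  also have "norm \<dots> \<le> (1 - l') * norm (y - x) + l' * norm (G y - G x) + \<bar>l' - l\<bar> * norm (G x - x)"
    using l by (intro norm_triangle_le add_mono) auto
  also have "\<dots> \<le> (1 - l') * (B * l) + l' * (\<tau> * (B * l)) + (\<delta> * l'\<^sup>2) * d"
    using l sl yx Gyx \<delta> by (intro add_mono mult_mono dist_le G_mem xy) (auto simp: abs_minus_commute)
  also have "\<dots> = B * (l * (1 - (1 - \<tau>) * l')) + \<delta> * l'\<^sup>2 * d" by (simp add: algebra_simps)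
  also have "\<dots> \<le> B * ((l' * (1 + \<delta> * l')) * (1 - (1 - \<tau>) * l')) + \<delta> * l'\<^sup>2 * B"
  proof (intro add_mono mult_left_mono mult_right_mono dB)
    show "l \<le> l' * (1 + \<delta> * l')" using sl by (simp add: power2_eq_square algebra_simps abs_le_iff)
    have "(1 - \<tau>) * l' \<le> 1 * 1" using \<tau> l by (intro mult_mono) auto
    then show "0 \<le> 1 - (1 - \<tau>) * l'" by simp
  qed (use B0 \<delta> l in auto)
  also have "\<dots> \<le> B * l'"
  proof -
    have "(l' * (1 + \<delta> * l')) * (1 - (1 - \<tau>) * l') + \<delta> * l'\<^sup>2
        = l' - l'\<^sup>2 * ((1 - \<tau>) - 2 * \<delta> + \<delta> * (1 - \<tau>) * l')"
      by (simp add: power2_eq_square algebra_simps)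
    also have "\<dots> \<le> l'"
    proof -
      have "0 \<le> (1 - \<tau>) - 2 * \<delta>" using \<delta> \<tau> by simp
      moreover have "0 \<le> \<delta> * (1 - \<tau>) * l'" using \<delta> \<tau> l by simp
      ultimately show ?thesis using l by (simp add: add_nonneg_nonneg)
    qed
    finally have "B * ((l' * (1 + \<delta> * l')) * (1 - (1 - \<tau>) * l') + \<delta> * l'\<^sup>2) \<le> B * l'"
      using B0 by (rule mult_left_mono)
    then show ?thesis by (simp add: algebra_simps)
  qed
  finally show ?case by (simp add: l'_def)
qed

lemma Tu_displacement:
  assumes "norm (u (Suc n) - u n) \<le> B * lam (Suc n)"
  shows "norm (u (Suc n) - T (u (Suc n))) \<le> (d + B) * lam (Suc n)"
    and "norm (T (u (Suc n)) - T (T (u (Suc n)))) \<le> (d + B) * lam (Suc n)"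
proof -
  have "u (Suc n) - T (u (Suc n)) = lam (Suc n) *\<^sub>R (G (T (u n)) - T (u n)) + (T (u n) - T (u (Suc n)))"
    by (subst (1) u_Suc) (simp add: algebra_simps)
  also have "norm \<dots> \<le> lam (Suc n) * norm (G (T (u n)) - T (u n)) + norm (T (u n) - T (u (Suc n)))"
    using lam(1)[of "Suc n"] by (intro norm_triangle_le) auto
  also have "\<dots> \<le> lam (Suc n) * d + norm (u n - u (Suc n))"
    using lam(1)[of "Suc n"]
    by (intro add_mono mult_left_mono dist_le T_nonexp G_mem Tu_mem u_mem) auto
  finally show 1: "norm (u (Suc n) - T (u (Suc n))) \<le> (d + B) * lam (Suc n)"
    using assms by (simp add: norm_minus_commute algebra_simps)
  show "norm (T (u (Suc n)) - T (T (u (Suc n)))) \<le> (d + B) * lam (Suc n)"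
    using T_nonexp[OF u_mem Tu_mem] 1 by (rule order_trans)
qed

lemma Tu_sq_dist_recursion:
  assumes q: "q \<in> C" "norm (q - T q) \<le> r"
  shows "(norm (T (u (Suc n)) - q))\<^sup>2 \<le> (norm (T (u n) - q))\<^sup>2
    + lam (Suc n) * (2 * ((G (T (u n)) - T (u n)) \<bullet> (T (u n) - q))) + (lam (Suc n) * d)\<^sup>2 + 3 * d * r"
proof -
  define t l where "t = T (u n)" and "l = lam (Suc n)"
  define s where "s = norm (q - T q)"
  have s: "0 \<le> s" "s \<le> r" "s \<le> d" using q dist_le[OF q(1) T_mem[OF q(1)]] by (auto simp: s_def)
  have t: "t \<in> C" by (simp add: t_def Tu_mem)
  have l: "0 < l" by (simp add: l_def lam)
  have "norm (T (u (Suc n)) - q) \<le> norm (T (u (Suc n)) - T q) + norm (T q - q)"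
    using norm_triangle_ineq[of "T (u (Suc n)) - T q" "T q - q"] by simp
  also have "\<dots> \<le> norm (u (Suc n) - q) + s"
    using T_nonexp[OF u_mem q(1), of "Suc n"] by (simp add: s_def norm_minus_commute)
  finally have "(norm (T (u (Suc n)) - q))\<^sup>2 \<le> (norm (u (Suc n) - q) + s)\<^sup>2" by (intro power_mono) auto
  also have "\<dots> = (norm (u (Suc n) - q))\<^sup>2 + (2 * norm (u (Suc n) - q) + s) * s"
    by (simp add: power2_eq_square algebra_simps)
  also have "(2 * norm (u (Suc n) - q) + s) * s \<le> (2 * d + d) * r"
    using dist_le[OF u_mem q(1), of "Suc n"] s d_nonneg by (intro mult_mono add_mono) auto
  also have "(norm (u (Suc n) - q))\<^sup>2 = (norm ((t - q) + l *\<^sub>R (G t - t)))\<^sup>2"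
    unfolding u_Suc t_def l_def by (simp add: algebra_simps)
  also have "\<dots> = (norm (t - q))\<^sup>2 + l * (2 * ((G t - t) \<bullet> (t - q))) + (l * norm (G t - t))\<^sup>2"
    unfolding power_mult_distrib power2_norm_eq_inner
    by (simp add: inner_add_left inner_add_right inner_commute power2_eq_square algebra_simps)
  also have "(l * norm (G t - t))\<^sup>2 \<le> (l * d)\<^sup>2"
    using l dist_le[OF G_mem[OF t] t] by (intro power_mono mult_left_mono) auto
  finally show ?thesis by (simp add: t_def l_def)
qed

text \<open>
  The recursion for the squared distances from \<open>T (u n)\<close> to \<open>q\<close> is summed over the window with weights
  \<open>p n\<close> that grow by the factor \<open>1 / (1 - \<kappa> lam n)\<close>. The discount produces the terms with \<open>\<kappa>\<close>, and the
  starting point of the window is negligible if \<open>p b\<close> is large. The latter follows from the slow variation of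
  \<open>lam\<close>: as \<open>lam\<close> decreases at step \<open>n\<close> at most by the factor \<open>1 / (1 + \<delta> lam n)\<close>, and \<open>\<delta> \<le> \<kappa>\<close>, the product \<open>p b\<close> is at least the ratio
  \<open>lam a / lam b\<close>. The three parts of \<open>\<eta>\<close> account for the starting point, the second order terms and the
  displacement of \<open>q\<close>.
\<close>

lemma window_approx_solution:
  assumes \<kappa>: "0 < \<kappa>" "\<kappa> \<le> 1/4" and \<delta>: "0 \<le> \<delta>" "\<delta> \<le> \<kappa>"
    and slow: "\<And>n. n1 \<le> n \<Longrightarrow> \<bar>lam n - lam (Suc n)\<bar> \<le> \<delta> * (lam (Suc n))\<^sup>2"
    and win: "n1 \<le> a" "a \<le> b"
    and A: "\<And>n. a \<le> n \<Longrightarrow> n < b \<Longrightarrow> T (u n) \<in> A"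
    and B: "\<And>q. q \<in> B \<Longrightarrow> q \<in> C \<and> norm (q - T q) \<le> r"
    and small: "\<And>n. a \<le> n \<Longrightarrow> lam n * d\<^sup>2 \<le> \<eta> / 3"
    and fixed: "\<And>n. n \<le> b \<Longrightarrow> 3 * d * r \<le> \<eta> / 3 * lam n"
    and long: "\<kappa> * d\<^sup>2 \<le> \<eta> / 3 * (lam a / lam b - 1)" and decay: "lam b < lam a"
  shows "\<exists>I w. approx_solution \<kappa> \<eta> G A B I w (\<lambda>n. T (u n)) (T (u b))"
proof -
  define p where "p n = (\<Prod>i\<in>{a<..n}. 1 / (1 - \<kappa> * lam i))" for n
  have lt: "0 < 1 - \<kappa> * lam i" for i
    using mult_mono[OF \<kappa>(2) lam(2)[of i]] lam(1)[of i] \<kappa> by simp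
  have p_pos: "0 < p n" for n unfolding p_def using lt by (intro prod_pos) auto
  have pa: "p a = 1" by (simp add: p_def)
  have p_Suc: "p (Suc n) * (1 - \<kappa> * lam (Suc n)) = p n" if "a \<le> n" for n
  proof -
    have "{a<..Suc n} = insert (Suc n) {a<..n}" using that by auto
    then show ?thesis using lt[of "Suc n"] by (simp add: p_def)
  qed
  have p_ge: "lam a / lam n \<le> p n" if "a \<le> n" for n
    using that
  proof (induction rule: dec_induct)
    case base then show ?case using lam(1)[of a] by (simp add: pa)
  next
    case (step n)
    define l where "l = lam (Suc n)"
    have l: "0 < l" by (simp add: l_def lam)
    have "lam n \<le> l * (1 + \<delta> * l)"
      using slow[of n] step win by (simp add: l_def power2_eq_square algebra_simps abs_le_iff)
    also have "\<dots> \<le> l * (1 + \<kappa> * l)" using l \<delta> by (intro mult_left_mono add_mono mult_right_mono) auto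
    finally have "lam n * (1 - \<kappa> * l) \<le> l * (1 + \<kappa> * l) * (1 - \<kappa> * l)"
      using lt[of "Suc n"] by (intro mult_right_mono) (auto simp: l_def)
    also have "\<dots> = l * (1 - (\<kappa> * l)\<^sup>2)" by (simp add: power2_eq_square algebra_simps)
    also have "\<dots> \<le> l * 1" using l by (intro mult_left_mono) auto
    finally have key: "lam n * (1 - \<kappa> * l) \<le> l" by simp
    have "lam a \<le> p n * lam n" using step lam(1)[of n] by (simp add: pos_divide_le_eq)
    also have "p n = p (Suc n) * (1 - \<kappa> * l)" using p_Suc[of n] step by (simp add: l_def)
    also have "p (Suc n) * (1 - \<kappa> * l) * lam n = p (Suc n) * (lam n * (1 - \<kappa> * l))" by simp
    also have "\<dots> \<le> p (Suc n) * l" using key p_pos by (intro mult_left_mono) (auto simp: less_imp_le)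
    finally show ?case using l by (simp add: pos_divide_le_eq l_def)
  qed
  define c \<Omega> where "c n = p (Suc n) * lam (Suc n)" and "\<Omega> = (\<Sum>n=a..<b. c n)" for n
  have c0: "0 < c n" for n by (simp add: c_def p_pos lam)
  have c_eq: "\<kappa> * c n = p (Suc n) - p n" if "a \<le> n" for n
    using p_Suc[OF that] by (simp add: c_def algebra_simps)
  have \<Omega>: "\<kappa> * \<Omega> = p b - 1"
  proof -
    have "\<kappa> * \<Omega> = (\<Sum>n=a..<b. p (Suc n) - p n)" unfolding \<Omega>_def sum_distrib_left by (intro sum.cong) (auto simp: c_eq)
    then show ?thesis using sum_Suc_diff'[OF win(2), of p] pa by simp
  qed
  have pb: "1 < p b" using p_ge[OF win(2)] decay lam(1)[of b] less_divide_eq_1_pos[of "lam b" "lam a"] by linarith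
  have \<Omega>0: "0 < \<Omega>" using \<Omega> pb \<kappa> zero_less_mult_pos[of \<kappa> \<Omega>] by linarith
  have \<eta>0: "0 \<le> \<eta>" using small[of a] mult_nonneg_nonneg[OF less_imp_le[OF lam(1)[of a]] zero_le_power2[of d]] by linarith
  have d\<Omega>: "d\<^sup>2 \<le> \<eta> / 3 * \<Omega>"
  proof -
    have "\<kappa> * d\<^sup>2 \<le> \<eta> / 3 * (lam a / lam b - 1)" by (rule long)
    also have "\<dots> \<le> \<eta> / 3 * (\<kappa> * \<Omega>)" using \<Omega> p_ge[OF win(2)] \<eta>0 by (intro mult_left_mono) auto
    finally have "\<kappa> * d\<^sup>2 \<le> \<kappa> * (\<eta> / 3 * \<Omega>)" by (simp only: mult_ac)
    then show ?thesis using \<kappa> by (simp only: mult_le_cancel_left_pos)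
  qed
  define t where "t n = T (u n)" for n
  have main: "\<kappa> * (norm (t b - q))\<^sup>2 \<le> (\<Sum>n\<in>{a..<b}. c n / \<Omega> *
      (\<kappa> * (norm (t n - q))\<^sup>2 + 2 * ((G (t n) - t n) \<bullet> (t n - q)))) + \<eta>" if q: "q \<in> B" for q
  proof -
    define D f where "D n = (norm (t n - q))\<^sup>2" and "f n = 2 * ((G (t n) - t n) \<bullet> (t n - q))" for n
    have qC: "q \<in> C" "norm (q - T q) \<le> r" using B[OF q] by auto
    have inc: "p (Suc n) * D (Suc n) - p n * D n \<le> c n * (\<kappa> * D n + f n) + c n * (2 / 3 * \<eta>)"
      if n: "a \<le> n" "n < b" for n
    proof -
      define l where "l = lam (Suc n)"
      have l: "0 < l" by (simp add: l_def lam)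
      have "D (Suc n) \<le> D n + l * f n + (l * d)\<^sup>2 + 3 * d * r"
        using Tu_sq_dist_recursion[OF qC, of n] by (simp add: D_def f_def l_def t_def)
      moreover have "(l * d)\<^sup>2 \<le> l * (\<eta> / 3)"
        using small[of "Suc n"] n l mult_left_mono[of "l * d\<^sup>2" "\<eta> / 3" l]
        by (simp add: l_def power2_eq_square algebra_simps)
      moreover have "3 * d * r \<le> \<eta> / 3 * l" using fixed[of "Suc n"] n by (simp add: l_def)
      ultimately have "D (Suc n) \<le> D n + l * (f n + 2 / 3 * \<eta>)" by (simp add: algebra_simps)
      then have "p (Suc n) * D (Suc n) \<le> p (Suc n) * (D n + l * (f n + 2 / 3 * \<eta>))"
        using p_pos by (intro mult_left_mono) (auto simp: less_imp_le)
      also have "\<dots> = p (Suc n) * D n + c n * (f n + 2 / 3 * \<eta>)" by (simp add: c_def l_def algebra_simps)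
      also have "p (Suc n) * D n = (p n + \<kappa> * c n) * D n" using c_eq[OF n(1)] by simp
      also have "\<dots> + c n * (f n + 2 / 3 * \<eta>) = p n * D n + (c n * (\<kappa> * D n + f n) + c n * (2 / 3 * \<eta>))"
        by (simp add: algebra_simps)
      finally show ?thesis by linarith
    qed
    have "p b * D b - p a * D a = (\<Sum>n=a..<b. p (Suc n) * D (Suc n) - p n * D n)"
      using sum_Suc_diff'[OF win(2), of "\<lambda>n. p n * D n"] by simp
    also have "\<dots> \<le> (\<Sum>n=a..<b. c n * (\<kappa> * D n + f n) + c n * (2 / 3 * \<eta>))" by (intro sum_mono inc) auto
    also have "\<dots> = (\<Sum>n=a..<b. c n * (\<kappa> * D n + f n)) + \<Omega> * (2 / 3 * \<eta>)"
      by (simp only: sum.distrib \<Omega>_def sum_distrib_right)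
    finally have 1: "p b * D b \<le> D a + (\<Sum>n=a..<b. c n * (\<kappa> * D n + f n)) + \<Omega> * (2 / 3 * \<eta>)"
      by (simp add: pa)
    have "D a \<le> d\<^sup>2" using dist_le[OF Tu_mem qC(1)] unfolding D_def t_def by (intro power_mono) auto
    moreover have "(\<kappa> * \<Omega>) * D b \<le> p b * D b" unfolding \<Omega> by (intro mult_right_mono) (auto simp: D_def)
    ultimately have "\<Omega> * (\<kappa> * D b) \<le> (\<Sum>n=a..<b. c n * (\<kappa> * D n + f n)) + \<Omega> * \<eta>"
      using 1 d\<Omega> by (simp add: algebra_simps)
    then have "\<kappa> * D b \<le> ((\<Sum>n=a..<b. c n * (\<kappa> * D n + f n)) + \<Omega> * \<eta>) / \<Omega>"
      using \<Omega>0 by (simp add: pos_le_divide_eq mult.commute)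
    also have "\<dots> = (\<Sum>n=a..<b. c n / \<Omega> * (\<kappa> * D n + f n)) + \<eta>"
      using \<Omega>0 by (simp add: add_divide_distrib sum_divide_distrib)
    finally show ?thesis by (simp add: D_def f_def)
  qed
  have "sum (\<lambda>n. c n / \<Omega>) {a..<b} = 1" using \<Omega>0 unfolding \<Omega>_def by (simp flip: sum_divide_distrib)
  then have "approx_solution \<kappa> \<eta> G A B {a..<b} (\<lambda>n. c n / \<Omega>) (\<lambda>n. T (u n)) (T (u b))"
    unfolding approx_solution_def using main c0 \<Omega>0 A by (auto simp: t_def less_imp_le)
  then show ?thesis by blast
qed

end

section \<open>Metastability\<close>

lemma f_fun_ge:
  "24 * real d * (1 - \<tau>) * real (max_upto h (max_upto (max_id g) (chi (d * n)))) / e\<^sup>2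
    \<le> real (f_fun \<tau> e g chi h d n)"
  unfolding f_fun_def by (simp add: power_divide) linarith

text \<open>
  The function \<^const>\<open>f_fun\<close> carries a factor \<open>1 - \<tau>\<close>, where the argument needs a multiple of its inverse. As
  \<open>F\<close> grows at least quadratically, a second application makes up for this once \<open>k\<close> is at least
  the third power of \<open>1 / (1 - \<tau>)\<close>.
\<close>

lemma two_steps_dominate_horizon:
  fixes \<tau> e :: real and chi h g :: "nat \<Rightarrow> nat" and d k :: nat
  defines "H \<equiv> max_upto h (max_upto (max_id g) (chi (d * k)))"
    and "F \<equiv> tilde d (f_fun \<tau> e g chi h d)"
  assumes \<tau>: "0 \<le> \<tau>" "\<tau> < 1" and d: "0 < d" and e: "0 < e" "e \<le> 1"
    and k: "1 \<le> real k * (1 - \<tau>) ^ 3" and H: "k \<le> H"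
  shows "144 * real d * real H / ((1 - \<tau>) * e\<^sup>2) \<le> real (F (F k))"
proof -
  define \<rho> where "\<rho> = 1 - \<tau>"
  have \<rho>: "0 < \<rho>" using \<tau> by (simp add: \<rho>_def)
  define a where "a = 24 * real d * \<rho> * real H / e\<^sup>2"
  have "a \<le> real (f_fun \<tau> e g chi h d k)" unfolding a_def \<rho>_def H_def by (rule f_fun_ge)
  also have "\<dots> \<le> real (F k)" unfolding F_def by (simp add: tilde_ge_fun le_square d)
  finally have aF: "a \<le> real (F k)" .
  have a0: "0 \<le> a" using \<rho> by (simp add: a_def)
  have "1 \<le> real k * \<rho> ^ 3" using k by (simp add: \<rho>_def)
  also have "\<dots> \<le> real H * \<rho> ^ 3" using H \<rho> by (intro mult_right_mono) auto
  finally have H1: "1 \<le> real H * \<rho> ^ 3" .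
  have "144 * real d * real H / (\<rho> * e\<^sup>2) * 1 \<le> 144 * real d * real H / (\<rho> * e\<^sup>2) * (real H * \<rho> ^ 3)"
    using H1 \<rho> by (intro mult_left_mono) auto
  also have "\<dots> = 144 * real d * real H ^ 2 * \<rho>\<^sup>2 / e\<^sup>2"
    using \<rho> e by (simp add: field_simps power2_eq_square power3_eq_cube)
  also have "\<dots> \<le> 9216 * real d ^ 3 * real H ^ 2 * \<rho>\<^sup>2 / e ^ 4"
  proof (rule frac_le)
    have "real d \<le> real d ^ 3" using self_le_power[of "real d" 3] d by simp
    then have "144 * real d \<le> 9216 * real d ^ 3" by linarith
    then have "144 * real d * (real H ^ 2 * \<rho>\<^sup>2) \<le> 9216 * real d ^ 3 * (real H ^ 2 * \<rho>\<^sup>2)"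
      by (intro mult_right_mono) auto
    then show "144 * real d * real H ^ 2 * \<rho>\<^sup>2 \<le> 9216 * real d ^ 3 * real H ^ 2 * \<rho>\<^sup>2"
      by (simp only: mult.assoc)
    show "e ^ 4 \<le> e\<^sup>2" using e by (intro power_decreasing) auto
  qed (use e in auto)
  also have "\<dots> = 16 * real d * a\<^sup>2"
    using e by (simp add: a_def power_divide power_mult_distrib power2_eq_square power3_eq_cube power4_eq_xxxx mult_ac)
  also have "\<dots> \<le> 16 * real d * (real (F k))\<^sup>2"
    using a0 aF by (intro mult_left_mono power_mono) auto
  also have "\<dots> = real (16 * d * (F k)\<^sup>2)" by simp
  also have "\<dots> \<le> real (F (F k))" unfolding F_def of_nat_le_iff by (rule tilde_ge_square)
  finally show ?thesis by (simp add: \<rho>_def)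
qed


(* phi1 and phi2 are only constrained, and only used, at positive reals.  The rate of divergence
   phi1 has to be correct at every positive real, since c evaluates it at a real argument that
   need not be an integer; at k = 0 its defining inequality is trivial. *)
theorem theorem6p10:
  fixes C :: "'a::{real_inner, complete_space} set"
    and T G :: "'a \<Rightarrow> 'a" and u :: "nat \<Rightarrow> 'a" and v :: 'a
    and d :: nat and \<tau> \<epsilon> :: real
    and lam :: "nat \<Rightarrow> real" and h chi g :: "nat \<Rightarrow> nat"
    and \<phi>1 \<phi>2 :: "real \<Rightarrow> nat"
  assumes d_pos: "d > 0"
    and C: "bounded C" "closed C" "convex C" and diam: "diameter C \<le> real d"
    and T: "T ` C \<subseteq> C" "1-lipschitz_on C T"
    and G: "G ` C \<subseteq> C" "\<tau>-lipschitz_on C G" "\<tau> < 1"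
    and lam: "\<And>n. 0 < lam n" "\<And>n. lam n \<le> 1" "lam \<longlonglongrightarrow> 0"
    and h: "\<And>n. h n > 0" "\<And>n. lam n \<ge> 1 / real (h n)"
    and chi_rate: "\<And>n i. i \<ge> chi n \<Longrightarrow> lam i \<le> 1 / (real n + 1)"
    and phi1: "\<And>k::real. k > 0 \<Longrightarrow> (\<Sum>i = 1..\<phi>1 k. lam i) \<ge> k"
    and phi2: "\<And>\<delta> n. \<delta> > 0 \<Longrightarrow> n \<ge> \<phi>2 \<delta> \<Longrightarrow> \<bar>lam n - lam (n + 1)\<bar> / (lam (n + 1))\<^sup>2 \<le> \<delta>"
    and u0: "u 0 \<in> C"
    and u_Suc: "\<And>n. u (n + 1) = (1 - lam (n + 1)) *\<^sub>R T (u n) + lam (n + 1) *\<^sub>R G (T (u n))"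
    and eps: "0 < \<epsilon>" "\<epsilon> \<le> 1"
    and v: "v \<in> C"
  shows "let c = \<phi>1 ((real (\<phi>2 ((1 - \<tau>) * \<epsilon> / (6 * real d))) + ln (6 * real d / \<epsilon>)) / (1 - \<tau>));
             g_c = (\<lambda>n. n + c + g (n + c))
         in \<exists>n \<le> Xi \<tau> (\<epsilon> / 6) g_c chi h d + c.
              \<forall>i \<in> {n..n + g n}. \<forall>j \<in> {n..n + g n}. norm (u i - u j) \<le> \<epsilon>"
proof -
  define e \<rho> where "e = \<epsilon> / 6" and "\<rho> = 1 - \<tau>"
  define \<delta> where "\<delta> = (1 - \<tau>) * \<epsilon> / (6 * real d)"
  define n1 where "n1 = \<phi>2 \<delta>"
  define c where "c = \<phi>1 ((real n1 + ln (6 * real d / \<epsilon>)) / (1 - \<tau>))"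
  define g_c where "g_c = (\<lambda>n. n + c + g (n + c))"
  have e: "0 < e" "6 * e \<le> 1" "e \<le> 1" using eps by (auto simp: e_def)
  have d1: "1 \<le> real d" using d_pos by simp
  have \<tau>0: "0 \<le> \<tau>" using G(2) by (rule lipschitz_on_nonneg)
  have \<rho>: "0 < \<rho>" "\<rho> \<le> 1" using G(3) \<tau>0 by (auto simp: \<rho>_def)
  have \<delta>_eq: "\<delta> = \<rho> * (e / real d)" by (simp add: \<delta>_def e_def \<rho>_def)
  have ed: "e / real d \<le> 1/6" using e d1 frac_le[of "1/6" e 1 "real d"] by simp
  have \<delta>: "0 < \<delta>" "\<delta> \<le> (1 - \<tau>) / 6"
    using \<rho> e d_pos mult_left_mono[OF ed, of \<rho>] by (auto simp: \<delta>_eq \<rho>_def)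
  have slow: "\<bar>lam n - lam (Suc n)\<bar> \<le> \<delta> * (lam (Suc n))\<^sup>2" if "n1 \<le> n" for n
    using phi2[OF \<delta>(1), of n] that lam(1)[of "Suc n"] by (simp add: n1_def pos_divide_le_eq)
  interpret viscosity_iteration C T G \<tau> "real d" lam u
  proof
    fix x y assume xy: "x \<in> C" "y \<in> C"
    show "norm (x - y) \<le> real d"
      using diameter_bounded_bound[OF C(1) xy] diam by (simp add: dist_norm)
    show "norm (T x - T y) \<le> norm (x - y)" "norm (G x - G y) \<le> \<tau> * norm (x - y)"
      using lipschitz_onD[OF T(2) xy] lipschitz_onD[OF G(2) xy] by (auto simp: dist_norm)
  qed (use C T G \<tau>0 lam u0 u_Suc in auto)

  \<comment> \<open>Each \<open>lam i\<close> is at most 1, so a rate of divergence is at least its argument.\<close>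
  have c_gt: "Suc n1 \<le> c"
  proof -
    define k where "k = (real n1 + ln (6 * real d / \<epsilon>)) / (1 - \<tau>)"
    have "3 \<le> 6 * real d / \<epsilon>" using eps d1 by (simp add: field_simps)
    then have "1 \<le> ln (6 * real d / \<epsilon>)" using exp_le by (subst ln_ge_iff) auto
    then have "(real n1 + 1) * 1 \<le> (real n1 + ln (6 * real d / \<epsilon>)) * (1 / \<rho>)"
      using \<rho> by (intro mult_mono) auto
    then have k: "real n1 + 1 \<le> k" by (simp add: k_def \<rho>_def)
    then have "k \<le> (\<Sum>i = 1..c. lam i)" using phi1[of k] by (simp add: c_def k_def)
    also have "\<dots> \<le> (\<Sum>i = 1..c. 1)" by (intro sum_mono lam)
    finally show ?thesis using k by simp
  qed

  \<comment> \<open>\<open>H x\<close> bounds \<open>1 / lam i\<close> for all \<open>i\<close> up to \<open>g_c (\<nu> x)\<close>, the end of the interval of length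
    \<open>g (c + \<nu> x)\<close> that starts at \<open>c + \<nu> x\<close>. The rate \<open>chi\<close> need not be monotone; the least index
    \<open>\<nu> x\<close> from which on \<open>lam\<close> is at most \<open>1 / (d x)\<close> is monotone in \<open>x\<close>.\<close>
  define F where "F = tilde d (f_fun \<tau> e g_c chi h d)"
  define H where "H k = max_upto h (max_upto (max_id g_c) (chi (d * k)))" for k
  define \<nu> where "\<nu> x = (LEAST i. \<forall>l\<ge>i. real d * real x * lam l \<le> 1)" for x :: nat
  have chi_ok: "\<forall>l\<ge>chi (d * x). real d * real x * lam l \<le> 1" for x
  proof (intro allI impI)
    fix l assume "chi (d * x) \<le> l"
    then have "lam l \<le> 1 / (real (d * x) + 1)" by (rule chi_rate)
    then have "lam l * (real (d * x) + 1) \<le> 1" by (subst (asm) pos_le_divide_eq) (auto intro: add_nonneg_pos)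
    then show "real d * real x * lam l \<le> 1" using lam(1)[of l] by (simp add: algebra_simps)
  qed
  have \<nu>_le: "\<nu> x \<le> chi (d * x)" for x using Least_le[of "\<lambda>i. \<forall>l\<ge>i. real d * real x * lam l \<le> 1" "chi (d * x)"] chi_ok[of x]
    unfolding \<nu>_def by blast
  have \<nu>: "real d * real x * lam l \<le> 1" if "\<nu> x \<le> l" for x l
    using LeastI[of "\<lambda>i. \<forall>l\<ge>i. real d * real x * lam l \<le> 1" "chi (d * x)"] chi_ok[of x] that
    unfolding \<nu>_def by blast
  have \<nu>_mono: "\<nu> x \<le> \<nu> y" if "x \<le> y" for x y
  proof -
    have "real d * real x * lam l \<le> 1" if "\<nu> y \<le> l" for l
    proof -
      have "real d * real x * lam l \<le> real d * real y * lam l"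
        using \<open>x \<le> y\<close> lam(1)[of l] by (intro mult_right_mono mult_left_mono) auto
      then show ?thesis using \<nu>[OF that] by linarith
    qed
    then show ?thesis
      using Least_le[of "\<lambda>i. \<forall>l\<ge>i. real d * real x * lam l \<le> 1" "\<nu> y"] unfolding \<nu>_def[of x] by blast
  qed
  have h_le: "h i \<le> H x" if "i \<le> g_c (\<nu> x)" for i x
  proof -
    have "i \<le> max_id g_c (\<nu> x)" using that by (simp add: max_id_def)
    also have "\<dots> \<le> max_upto (max_id g_c) (chi (d * x))" by (rule max_upto_ge[OF \<nu>_le])
    finally show ?thesis unfolding H_def by (rule max_upto_ge)
  qed
  have lam_ge: "1 \<le> real (H x) * lam i" if "i \<le> g_c (\<nu> x)" for i x
  proof -
    have "1 \<le> real (h i) * lam i" using h(2)[of i] h(1)[of i] by (simp add: field_simps)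
    also have "\<dots> \<le> real (H x) * lam i" using h_le[OF that] lam(1)[of i] by (intro mult_right_mono) auto
    finally show ?thesis .
  qed
  define H0 where "H0 = max_upto h c"
  have H0: "H0 \<le> H x" for x
  proof -
    have "c \<le> max_id g_c 0" by (simp add: max_id_def g_c_def)
    also have "\<dots> \<le> max_upto (max_id g_c) (chi (d * x))" by (rule max_upto_ge) simp
    finally show ?thesis unfolding H_def H0_def by (rule max_upto_mono)
  qed
  have H0_1: "1 \<le> H0" using max_upto_ge[of 0 c h] h(1)[of 0] by (simp add: H0_def)
  have le_H: "x \<le> H x" for x
  proof -
    let ?i = "chi (d * x)"
    have "?i \<le> max_id g_c ?i" by (simp add: max_id_def)
    also have "\<dots> \<le> max_upto (max_id g_c) ?i" by (rule max_upto_ge) simp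
    finally have hH: "h ?i \<le> H x" unfolding H_def by (rule max_upto_ge)
    have "1 / real (h ?i) \<le> 1 / (real (d * x) + 1)" using h(2)[of ?i] chi_rate[of "d * x" ?i] by simp
    then have "real (d * x) + 1 \<le> real (h ?i)"
      by (rule inverse_le_imp_le[unfolded inverse_eq_divide]) (simp add: h)
    then have "d * x \<le> h ?i" by linarith
    moreover have "x \<le> d * x" using d_pos by simp
    ultimately show ?thesis using hH by linarith
  qed

  define k where "k i = (F ^^ i) 1" for i
  have k_Suc: "k (Suc i) = F (k i)" for i by (simp add: k_def)
  have k_mono: "i \<le> j \<Longrightarrow> k i \<le> k j" for i j
    unfolding k_def F_def by (rule funpow_tilde_mono[OF d_pos])
  \<comment> \<open>For \<open>i \<ge> 3 * i1\<close>, \<open>k i\<close> is at least the third power of \<open>1 / (1 - \<tau>)\<close>.\<close>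
  define i1 where "i1 = max 1 (i_zero \<tau> e d)"
  have k_large: "1 \<le> real (k i) * (1 - \<tau>) ^ 3" if "3 * i1 \<le> i" for i
  proof -
    have "1 / (1 - \<tau>) \<le> 2 ^ i1"
      unfolding i1_def by (rule two_power_i_zero[OF \<tau>0 G(3) d_pos e(1,2)])
    then have "1 \<le> 2 ^ i1 * \<rho>" using \<rho> by (simp add: \<rho>_def field_simps)
    then have "1 ^ 3 \<le> (2 ^ i1 * \<rho>) ^ 3" by (intro power_mono) auto
    also have "\<dots> = 2 ^ (3 * i1) * \<rho> ^ 3" by (simp add: power_mult_distrib mult.commute flip: power_mult)
    also have "\<dots> \<le> real (k i) * \<rho> ^ 3"
    proof (rule mult_right_mono)
      have "2 ^ (3 * i1) \<le> k (3 * i1)" unfolding k_def F_def by (rule funpow_tilde_ge_two_power[OF d_pos])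
      also have "\<dots> \<le> k i" by (rule k_mono[OF that])
      finally have "real (2 ^ (3 * i1)) \<le> real (k i)" by (simp only: of_nat_le_iff)
      then show "2 ^ (3 * i1) \<le> real (k i)" by simp
    qed (use \<rho> in simp)
    finally show ?thesis by (simp add: \<rho>_def)
  qed
  have k_big: "144 * real d * real (H (k i)) \<le> real (k (i + 2)) * (\<rho> * e\<^sup>2)" if "3 * i1 \<le> i" for i
  proof -
    have "144 * real d * real (H (k i)) / (\<rho> * e\<^sup>2) \<le> real (F (F (k i)))"
      unfolding H_def F_def \<rho>_def
      by (rule two_steps_dominate_horizon)
        (fact \<tau>0 G(3) d_pos e(1) e(3) k_large[OF that] le_H[of "k i", unfolded H_def])+
    then show ?thesis using \<rho> e by (simp add: k_Suc pos_divide_le_eq)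
  qed

  \<comment> \<open>Of the eight iterations from \<open>K j\<close> to \<open>K (j + 1)\<close>, three ensure that \<open>T (u n)\<close> lies in \<open>K j\<close> from
    the beginning \<open>ns j\<close> of the window on, two that \<open>lam\<close> decays by a large factor between \<open>ns j\<close> and
    the interval to be found, two that the points of \<open>K (j + 1)\<close> are fixed up to an error well below
    \<open>lam\<close> on that interval, and one pays for taking the convex hull.\<close>
  define s where "s j = 3 * i1 + 8 * j" for j
  define K where "K j = almost_fixed_hull C T (1 / real (k (s j)))" for j
  define ns where "ns j = c + \<nu> (k (s j + 3))" for j
  have k_pos: "1 \<le> k i" for i using k_mono[of 0 i] by (simp add: k_def)
  have re: "\<rho> * e\<^sup>2 \<le> e" "\<rho> * e\<^sup>2 \<le> 1"
  proof -
    have "\<rho> * e\<^sup>2 \<le> 1 * (e * 1)" unfolding power2_eq_square using \<rho> e by (intro mult_mono) auto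
    then show "\<rho> * e\<^sup>2 \<le> e" "\<rho> * e\<^sup>2 \<le> 1" using e by auto
  qed
  have k_H: "144 * H (k i) \<le> k (i + 2)" if "3 * i1 \<le> i" for i
  proof -
    have "144 * 1 * real (H (k i)) \<le> 144 * real d * real (H (k i))" using d1 by (intro mult_right_mono) auto
    also have "\<dots> \<le> real (k (i + 2)) * (\<rho> * e\<^sup>2)" by (rule k_big[OF that])
    also have "\<dots> \<le> real (k (i + 2)) * 1" by (intro mult_left_mono re) simp
    finally show ?thesis by linarith
  qed
  have disp: "norm (u n - T (u n)) \<le> 1 / real (k (s j))" "norm (T (u n) - T (T (u n))) \<le> 1 / real (k (s j))"
    "norm (u n - T (u n)) \<le> e" if "ns j \<le> n" for n j
  proof -
    define y where "y = k (s j + 2)"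
    have sj: "3 * i1 \<le> s j" by (simp add: s_def)
    have yH: "144 * H (k (s j)) \<le> y" unfolding y_def by (rule k_H[OF sj])
    have n_c: "c + \<nu> (k (s j + 3)) \<le> n" using that by (simp add: ns_def)
    then obtain m where m: "n = Suc m" "n1 \<le> m" using c_gt by (cases n) auto
    \<comment> \<open>\<open>n1 + 1 \<le> c\<close> lies below all the bounds \<open>g_c (\<nu> x)\<close>, so \<open>lam (n1 + 1)\<close> is not too small.\<close>
    have B: "real d \<le> (real d * real H0) * lam (Suc n1)"
    proof -
      have "1 \<le> real (h (Suc n1)) * lam (Suc n1)" using h(2)[of "Suc n1"] h(1)[of "Suc n1"] by (simp add: field_simps)
      also have "\<dots> \<le> real H0 * lam (Suc n1)"
        using max_upto_ge[OF c_gt, of h] lam(1)[of "Suc n1"] by (intro mult_right_mono) (auto simp: H0_def)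
      finally show ?thesis using mult_left_mono[of 1 "real H0 * lam (Suc n1)" "real d"] by (simp add: mult.assoc)
    qed
    have inc: "norm (u (Suc m) - u m) \<le> (real d * real H0) * lam (Suc m)"
      by (rule increment_le[OF less_imp_le[OF \<delta>(1)] \<delta>(2) slow B m(2)])
    have "real (16 * d * y\<^sup>2) \<le> real (k (s j + 3))"
    proof -
      have "k (s j + 3) = F y" using k_Suc[of "s j + 2"] by (simp add: y_def eval_nat_numeral)
      then show ?thesis unfolding F_def of_nat_le_iff by (simp only: tilde_ge_square)
    qed
    then have "real d * real (16 * d * y\<^sup>2) * lam n \<le> real d * real (k (s j + 3)) * lam n"
      using lam(1)[of n] by (intro mult_right_mono mult_left_mono) auto
    also have "\<dots> \<le> 1" by (rule \<nu>) (use n_c in simp)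
    finally have lam_n: "16 * real d * (real d * real y * real y) * lam n \<le> 1"
      by (simp add: power2_eq_square mult_ac)
    have y0: "0 < real y" using k_pos[of "s j + 2"] by (simp add: y_def)
    have small: "(real d + real d * real H0) * lam n \<le> 1 / real y"
    proof -
      have "real d + real d * real H0 \<le> 2 * real d * real H0" using H0_1 d_pos by simp
      also have "\<dots> \<le> 16 * real d * (real d * real y)"
      proof -
        have "real H0 \<le> real y" using H0[of "k (s j)"] yH by linarith
        also have "\<dots> \<le> real d * real y" using d1 y0 by simp
        finally have "real d * real H0 \<le> real d * (real d * real y)" by (intro mult_left_mono) auto
        moreover have "0 \<le> real d * (real d * real y)" by simp
        ultimately show ?thesis by (simp only: mult.assoc)
      qed
      finally have "(real d + real d * real H0) * lam n \<le> 16 * real d * (real d * real y) * lam n"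
        using lam(1)[of n] by (intro mult_right_mono) auto
      also have "\<dots> \<le> 1 / real y" using lam_n y0 by (simp add: field_simps)
      finally show ?thesis .
    qed
    have "k (s j) \<le> y" unfolding y_def by (rule k_mono) simp
    then have y_k: "1 / real y \<le> 1 / real (k (s j))" using k_pos[of "s j"] by (intro divide_left_mono) auto
    have y_e: "1 / real y \<le> e"
    proof -
      have "1 \<le> H (k (s j))" using H0[of "k (s j)"] H0_1 by linarith
      then have "1 * 1 \<le> (144 * real d) * real (H (k (s j)))" using d1 by (intro mult_mono) auto
      also have "\<dots> \<le> real y * (\<rho> * e\<^sup>2)" using k_big[OF sj] by (simp add: y_def)
      also have "\<dots> \<le> real y * e" by (intro mult_left_mono re) simp
      finally show ?thesis using y0 by (simp add: field_simps)
    qed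
    show "norm (u n - T (u n)) \<le> 1 / real (k (s j))" "norm (T (u n) - T (T (u n))) \<le> 1 / real (k (s j))"
      "norm (u n - T (u n)) \<le> e"
      using Tu_displacement[OF inc] small y_k y_e m(1) by auto
  qed
  have K_mem: "T (u n) \<in> K j" if "ns j \<le> n" for n j
    unfolding K_def by (intro almost_fixed_hull_memI Tu_mem disp(2)[OF that])
  interpret nested_convex_sets C G \<tau> "real d" K
  proof
    show "K n \<subseteq> C" for n unfolding K_def by (rule almost_fixed_hull_subset[OF closed_C convex_C])
    show "closed (K n)" "convex (K n)" for n
      by (simp_all add: K_def closed_almost_fixed_hull convex_almost_fixed_hull)
    show "K n \<noteq> {}" for n using K_mem[of n "ns n"] by blast
    show "K n \<subseteq> K m" if "m \<le> n" for m n
      unfolding K_def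
      by (rule almost_fixed_hull_mono)
        (use k_mono[of "s m" "s n"] k_pos[of "s m"] that in \<open>auto simp: s_def intro!: divide_left_mono\<close>)
  qed (use dist_le convex_C G_mem G_lipschitz \<tau>0 G(3) in auto)

  define \<eta> where "\<eta> = \<rho> * e\<^sup>2 / 16"
  have "\<eta> \<le> (1 - \<tau>) * e\<^sup>2 / 16" by (simp add: \<eta>_def \<rho>_def)
  from stable_index_exists[OF refl d_pos e(1,2) this i1_def]
  obtain L j Q where L: "3 * i1 + 8 * L \<le> n_eps \<tau> e d ^ i1" and j: "j < L"
    and Q: "\<And>I w t x. approx_solution ((1 - \<tau>) / 4) \<eta> G (K j) (K (Suc j)) I w t x \<Longrightarrow> norm (x - Q) \<le> 2 * e"
    by blast
  define x' where "x' = k (s j + 5)"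
  define n where "n = c + \<nu> x'"
  have sj: "3 * i1 \<le> s j" by (simp add: s_def)
  have idx: "s j + 3 + 2 = s j + 5" "s j + 5 + 2 = s j + 7" by simp_all
  have near: "norm (u b - Q) \<le> 3 * e" if b: "n \<le> b" "b \<le> n + g n" for b
  proof -
    have xx': "k (s j + 3) \<le> x'" unfolding x'_def by (rule k_mono) simp
    have nsn: "ns j \<le> n" unfolding ns_def n_def using \<nu>_mono[OF xx'] by simp
    have b_le: "b \<le> g_c (\<nu> x')" using b by (simp add: g_c_def n_def add_ac)
    have ns_le: "ns j \<le> g_c (\<nu> (k (s j + 3)))" by (simp add: ns_def g_c_def)
    have ratio: "144 * real d * real d \<le> (lam (ns j) / lam b) * (\<rho> * e\<^sup>2)"
    proof -
      have "(144 * real d) * 1 \<le> (144 * real d) * (real (H (k (s j + 3))) * lam (ns j))"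
        by (intro mult_left_mono lam_ge[OF ns_le]) simp
      also have "\<dots> \<le> real x' * (\<rho> * e\<^sup>2) * lam (ns j)"
        using mult_right_mono[OF k_big[of "s j + 3", unfolded idx], of "lam (ns j)"] sj lam(1)[of "ns j"]
        by (simp add: x'_def mult.assoc)
      finally have "real d * lam b * (144 * real d) \<le> real d * lam b * (real x' * (\<rho> * e\<^sup>2) * lam (ns j))"
        using lam(1)[of b] by (intro mult_left_mono) auto
      also have "\<dots> = real d * real x' * lam b * (\<rho> * e\<^sup>2 * lam (ns j))" by simp
      also have "\<dots> \<le> 1 * (\<rho> * e\<^sup>2 * lam (ns j))"
        using b \<rho> lam(1)[of "ns j"] by (intro mult_right_mono \<nu>) (auto simp: n_def)
      finally show ?thesis using lam(1)[of b] by (simp add: field_simps)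
    qed
    have big_ratio: "1 + 12 * (real d)\<^sup>2 / e\<^sup>2 \<le> lam (ns j) / lam b"
    proof -
      note ratio
      also have "lam (ns j) / lam b * (\<rho> * e\<^sup>2) \<le> lam (ns j) / lam b * (1 * e\<^sup>2)"
        using \<rho> lam(1)[of "ns j"] lam(1)[of b] by (intro mult_left_mono mult_right_mono) auto
      finally have "144 * real d * real d \<le> lam (ns j) / lam b * (1 * e\<^sup>2)" .
      then have "144 * (real d)\<^sup>2 / e\<^sup>2 \<le> lam (ns j) / lam b"
        using e by (simp add: pos_divide_le_eq power2_eq_square)
      moreover have "1 \<le> (real d)\<^sup>2 / e\<^sup>2"
        using power_mono[of e "real d" 2] e d1 by (simp add: field_simps)
      ultimately show ?thesis by linarith
    qed
    have "\<exists>I w. approx_solution (\<rho> / 4) \<eta> G (K j) (K (Suc j)) I w (\<lambda>n. T (u n)) (T (u b))"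
    proof (rule window_approx_solution[where \<delta> = \<delta> and a = "ns j" and r = "1 / real (k (s j + 7))"])
      show "0 < \<rho> / 4" "\<rho> / 4 \<le> 1/4" using \<rho> by auto
      show "0 \<le> \<delta>" "\<delta> \<le> \<rho> / 4" using \<delta> \<rho> by (auto simp: \<rho>_def)
      show "\<bar>lam n - lam (Suc n)\<bar> \<le> \<delta> * (lam (Suc n))\<^sup>2" if "n1 \<le> n" for n by (rule slow[OF that])
      show "n1 \<le> ns j" using c_gt by (simp add: ns_def)
      show "ns j \<le> b" using nsn b by simp
      show "T (u n) \<in> K j" if "ns j \<le> n" for n by (rule K_mem[OF that])
      show "q \<in> C \<and> norm (q - T q) \<le> 1 / real (k (s j + 7))" if q: "q \<in> K (Suc j)" for q
      proof
        show "q \<in> C" using q K(4) by blast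
        have "s (Suc j) = Suc (s j + 7)" by (simp add: s_def)
        then have step: "16 * d * (k (s j + 7))\<^sup>2 \<le> k (s (Suc j))"
          unfolding F_def by (simp only: k_Suc F_def tilde_ge_square)
        show "norm (q - T q) \<le> 1 / real (k (s j + 7))"
          by (rule almost_fixed_hull_displacement_reciprocal[where C = C and d = d])
            (fact closed_C convex_C T_nonexp dist_le d_pos k_pos[unfolded One_nat_def Suc_le_eq] step q[unfolded K_def])+
      qed
      show "lam n * (real d)\<^sup>2 \<le> \<eta> / 3" if n: "ns j \<le> n" for n
      proof -
        define X where "X = real (k (s j + 3))"
        have "144 * real d * 1 \<le> 144 * real d * real (H (k (s j)))"
          using H0[of "k (s j)"] H0_1 by (intro mult_left_mono) linarith+
        also have "\<dots> \<le> real (k (s j + 2)) * (\<rho> * e\<^sup>2)" by (rule k_big[OF sj])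
        also have "\<dots> \<le> X * (\<rho> * e\<^sup>2)"
          unfolding X_def using k_mono[of "s j + 2" "s j + 3"] \<rho> by (intro mult_right_mono) auto
        finally have "(real d * lam n) * (144 * real d) \<le> (real d * lam n) * (X * (\<rho> * e\<^sup>2))"
          using lam(1)[of n] by (intro mult_left_mono) auto
        also have "\<dots> = real d * X * lam n * (\<rho> * e\<^sup>2)" by simp
        also have "\<dots> \<le> 1 * (\<rho> * e\<^sup>2)"
          unfolding X_def using n \<rho> by (intro mult_right_mono \<nu>) (auto simp: ns_def)
        finally show ?thesis
          using mult_nonneg_nonneg[OF less_imp_le[OF lam(1)[of n]] zero_le_power2[of "real d"]]
          by (simp add: \<eta>_def power2_eq_square algebra_simps)
      qed
      show "3 * real d * (1 / real (k (s j + 7))) \<le> \<eta> / 3 * lam n" if n: "n \<le> b" for n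
      proof -
        have "144 * real d * 1 \<le> 144 * real d * (real (H x') * lam n)"
          by (intro mult_left_mono lam_ge) (use n b_le in auto)
        also have "\<dots> \<le> real (k (s j + 7)) * (\<rho> * e\<^sup>2) * lam n"
          using mult_right_mono[OF k_big[of "s j + 5", unfolded idx], of "lam n"] sj lam(1)[of n]
          by (simp add: x'_def mult.assoc)
        finally show ?thesis using k_pos[of "s j + 7"] by (simp add: \<eta>_def field_simps)
      qed
      have "\<rho> / 4 * (real d)\<^sup>2 = \<eta> / 3 * (12 * (real d)\<^sup>2 / e\<^sup>2)" using e by (simp add: \<eta>_def)
      also have "\<dots> \<le> \<eta> / 3 * (lam (ns j) / lam b - 1)"
        using big_ratio \<rho> by (intro mult_left_mono) (auto simp: \<eta>_def)
      finally show "\<rho> / 4 * (real d)\<^sup>2 \<le> \<eta> / 3 * (lam (ns j) / lam b - 1)" .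
      have "0 < 12 * (real d)\<^sup>2 / e\<^sup>2" using e d_pos by simp
      then have "1 < lam (ns j) / lam b" using big_ratio by linarith
      then show "lam b < lam (ns j)" using lam(1)[of b] by (simp add: less_divide_eq)
    qed
    then have "norm (T (u b) - Q) \<le> 2 * e" using Q unfolding \<rho>_def by blast
    moreover have "norm (u b - T (u b)) \<le> e" using disp(3)[of j b] nsn b by simp
    ultimately show ?thesis using norm_triangle_ineq[of "u b - T (u b)" "T (u b) - Q"] by simp
  qed
  have "n \<le> Xi \<tau> e g_c chi h d + c"
  proof -
    have "x' \<le> k (n_eps \<tau> e d ^ i1)" unfolding x'_def by (rule k_mono) (use j L in \<open>simp add: s_def\<close>)
    also have "\<dots> \<le> k_seq d (n_eps \<tau> e d) F (i_zero \<tau> e d)"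
      unfolding k_def F_def i1_def by (rule k_seq_ge[OF d_pos])
    finally have "\<nu> x' \<le> \<nu> (k_seq d (n_eps \<tau> e d) F (i_zero \<tau> e d))" by (rule \<nu>_mono)
    also have "\<dots> \<le> Xi \<tau> e g_c chi h d" unfolding Xi_def F_def by (rule \<nu>_le)
    finally show ?thesis by (simp add: n_def)
  qed
  moreover have "norm (u i - u j) \<le> \<epsilon>" if "i \<in> {n..n + g n}" "j \<in> {n..n + g n}" for i j
    using norm_triangle_ineq4[of "u i - Q" "u j - Q"] near[of i] near[of j] that by (simp add: e_def)
  ultimately show ?thesis
    unfolding Let_def \<delta>_def[symmetric] n1_def[symmetric] c_def[symmetric] g_c_def[symmetric] e_def[symmetric]
    by blast
qed

end
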